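(* Let $g$ be a smooth $S^1$-invariant Riemannian metric on $S^2$ with total area $4\pi$ that corresponds to a surface of revolution in $\mathbb{R}^3$. Then its diameter satisfies $$D(g)>2\sqrt2,$$ where $2\sqrt2$ is the diameter of the singular surface obtained by gluing two flat discs, each of area $2\pi$, along their boundary circles.
   Context: $S^1$ acts on the unit sphere $S^2\subset\mathbb{R}^3$ by rotation about the vertical axis, fixing the North and South poles. A Riemannian metric $g$ on $S^2$ is $S^1$-invariant if this action is by isometries of $g$. The diameter $D(g)$ of $(S^2,g)$ equals the length of any geodesic meridian joining the North and South poles. An $S^1$-invariant metric $g$ corresponds to a surface of revolution in $\mathbb{R}^3$ if $(S^2,g)$ is $S^1$-equivariantly isometric to a smooth closed surface in $\mathbb{R}^3$ (with the metric induced from $\mathbb{R}^3$) obtained by revolving about the third coordinate axis a profile curve $t\mapsto(0,p(t),q(t))$, $0\le t\le\ell$, parametrized by arclength, with $p(0)=0=p(\ell)$, $p(t)>0$ for $0<t<\ell$, and (as smoothness at the poles requires) $\dot p(0)=1=-\dot p(\ell)$. *)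

theory Defs
  imports "HOL-Analysis.Analysis"
begin

subsection \<open>Smooth maps between subsets of Euclidean spaces\<close>

fun Ck_on :: "nat \<Rightarrow> 'a::euclidean_space set \<Rightarrow> ('a \<Rightarrow> 'b::euclidean_space) \<Rightarrow> bool" where
  "Ck_on 0 U f \<longleftrightarrow> continuous_on U f"
| "Ck_on (Suc k) U f \<longleftrightarrow>
     (\<forall>x\<in>U. f differentiable (at x)) \<and>
     (\<forall>v. Ck_on k U (\<lambda>x. frechet_derivative f (at x) v))"

text \<open>A map on an arbitrary subset is smooth if near each point of the subset it is the
  restriction of a smooth map defined on an open set.  For closed intervals this is smoothness
  up to the endpoints, for submanifolds it is the usual smoothness.\<close>

definition smooth_on :: "'a::euclidean_space set \<Rightarrow> ('a \<Rightarrow> 'b::euclidean_space) \<Rightarrow> bool" where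
  "smooth_on S f \<longleftrightarrow>
     (\<forall>x\<in>S. \<exists>U h. open U \<and> x \<in> U \<and> (\<forall>k. Ck_on k U h) \<and> (\<forall>y\<in>S \<inter> U. h y = f y))"

definition diffeomorphism ::
    "'a::euclidean_space set \<Rightarrow> 'b::euclidean_space set \<Rightarrow> ('a \<Rightarrow> 'b) \<Rightarrow> bool" where
  "diffeomorphism S T f \<longleftrightarrow> bij_betw f S T \<and> smooth_on S f \<and> smooth_on T (inv_into S f)"

definition smooth_closed_surface :: "(real^3) set \<Rightarrow> bool" where
  "smooth_closed_surface M \<longleftrightarrow> compact M \<and> connected M \<and>
     (\<forall>x\<in>M. \<exists>V (U :: (real^2) set) \<phi>.
        open V \<and> x \<in> V \<and> open U \<and> diffeomorphism U (M \<inter> V) \<phi>)"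

subsection \<open>Riemannian metrics on the unit sphere\<close>

abbreviation S2 :: "(real^3) set" where
  "S2 \<equiv> sphere 0 1"

definition tangent_S2 :: "real^3 \<Rightarrow> (real^3) set" where
  "tangent_S2 x = {v. v \<bullet> x = 0}"

text \<open>A metric is a function \<open>g x v w\<close>; only its values at points \<open>x\<close> of the sphere and
  vectors \<open>v\<close>, \<open>w\<close> tangent to the sphere at \<open>x\<close> are meaningful.\<close>

type_synonym sphere_metric = "real^3 \<Rightarrow> real^3 \<Rightarrow> real^3 \<Rightarrow> real"

definition smooth_riemannian_metric :: "sphere_metric \<Rightarrow> bool" where
  "smooth_riemannian_metric g \<longleftrightarrow>
     (\<forall>x\<in>S2. \<forall>u\<in>tangent_S2 x. \<forall>v\<in>tangent_S2 x. \<forall>w\<in>tangent_S2 x. \<forall>a b.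
        g x (a *\<^sub>R u + b *\<^sub>R v) w = a * g x u w + b * g x v w) \<and>
     (\<forall>x\<in>S2. \<forall>v\<in>tangent_S2 x. \<forall>w\<in>tangent_S2 x. g x v w = g x w v) \<and>
     (\<forall>x\<in>S2. \<forall>v\<in>tangent_S2 x. v \<noteq> 0 \<longrightarrow> g x v v > 0) \<and>
     (\<forall>X Y. smooth_on S2 X \<and> smooth_on S2 Y \<and>
        (\<forall>x\<in>S2. X x \<in> tangent_S2 x \<and> Y x \<in> tangent_S2 x) \<longrightarrow>
        smooth_on S2 (\<lambda>x. g x (X x) (Y x)))"

definition rot :: "real \<Rightarrow> real^3 \<Rightarrow> real^3" where
  "rot \<theta> x = vector [cos \<theta> * x$1 - sin \<theta> * x$2, sin \<theta> * x$1 + cos \<theta> * x$2, x$3]"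

text \<open>Rotations are linear, so each \<open>rot \<theta>\<close> is its own differential.\<close>

definition S1_invariant :: "sphere_metric \<Rightarrow> bool" where
  "S1_invariant g \<longleftrightarrow>
     (\<forall>\<theta>. \<forall>x\<in>S2. \<forall>v\<in>tangent_S2 x. \<forall>w\<in>tangent_S2 x.
        g (rot \<theta> x) (rot \<theta> v) (rot \<theta> w) = g x v w)"

definition sph :: "real \<Rightarrow> real \<Rightarrow> real^3" where
  "sph \<phi> \<theta> = vector [sin \<phi> * cos \<theta>, sin \<phi> * sin \<theta>, cos \<phi>]"

text \<open>The area is computed in spherical coordinates, as the integral of the square root of the
  Gram determinant; the coordinates cover the sphere injectively up to a null set.\<close>

definition area :: "sphere_metric \<Rightarrow> real" where
  "area g = integral ({0..pi} \<times> {0..2*pi}) (\<lambda>(\<phi>, \<theta>).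
     let x = sph \<phi> \<theta>;
         e1 = vector_derivative (\<lambda>s. sph s \<theta>) (at \<phi>);
         e2 = vector_derivative (\<lambda>s. sph \<phi> s) (at \<theta>)
     in sqrt (g x e1 e1 * g x e2 e2 - (g x e1 e2)\<^sup>2))"

text \<open>The relation \<open>has_integral\<close> discards curves of infinite length, which
  \<open>valid_path\<close> alone does not exclude (the velocity may be unbounded near finitely many points).\<close>

definition curve_has_length :: "sphere_metric \<Rightarrow> (real \<Rightarrow> real^3) \<Rightarrow> real \<Rightarrow> bool" where
  "curve_has_length g \<gamma> L \<longleftrightarrow>
     ((\<lambda>t. let v = vector_derivative \<gamma> (at t) in sqrt (g (\<gamma> t) v v)) has_integral L) {0..1}"

definition riemannian_dist :: "sphere_metric \<Rightarrow> real^3 \<Rightarrow> real^3 \<Rightarrow> real" where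
  "riemannian_dist g x y = Inf {L. \<exists>\<gamma>. valid_path \<gamma> \<and> path_image \<gamma> \<subseteq> S2 \<and>
     pathstart \<gamma> = x \<and> pathfinish \<gamma> = y \<and> curve_has_length g \<gamma> L}"

definition riemannian_diameter :: "sphere_metric \<Rightarrow> real" where
  "riemannian_diameter g = Sup {riemannian_dist g x y | x y. x \<in> S2 \<and> y \<in> S2}"

subsection \<open>Surfaces of revolution\<close>

definition profile_curve :: "real \<Rightarrow> (real \<Rightarrow> real) \<Rightarrow> (real \<Rightarrow> real) \<Rightarrow> bool" where
  "profile_curve l p q \<longleftrightarrow> l > 0 \<and> smooth_on {0..l} p \<and> smooth_on {0..l} q \<and>
     (\<forall>t\<in>{0..l}. (vector_derivative p (at t within {0..l}))\<^sup>2 +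
                 (vector_derivative q (at t within {0..l}))\<^sup>2 = 1) \<and>
     p 0 = 0 \<and> p l = 0 \<and> (\<forall>t. 0 < t \<and> t < l \<longrightarrow> p t > 0) \<and>
     vector_derivative p (at 0 within {0..l}) = 1 \<and>
     vector_derivative p (at l within {0..l}) = -1"

definition surface_of_revolution :: "real \<Rightarrow> (real \<Rightarrow> real) \<Rightarrow> (real \<Rightarrow> real) \<Rightarrow> (real^3) set" where
  "surface_of_revolution l p q = {rot \<theta> (vector [0, p t, q t]) | \<theta> t. t \<in> {0..l}}"

text \<open>The derivative \<open>A\<close> of \<open>F\<close> within the sphere is unique only on tangent vectors,
  and it is applied only to those.\<close>

definition isometry_onto :: "sphere_metric \<Rightarrow> (real^3) set \<Rightarrow> (real^3 \<Rightarrow> real^3) \<Rightarrow> bool" where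
  "isometry_onto g M F \<longleftrightarrow> diffeomorphism S2 M F \<and>
     (\<forall>x\<in>S2. \<exists>A. (F has_derivative A) (at x within S2) \<and>
        (\<forall>v\<in>tangent_S2 x. \<forall>w\<in>tangent_S2 x. g x v w = A v \<bullet> A w))"

definition corresponds_to_surface_of_revolution :: "sphere_metric \<Rightarrow> bool" where
  "corresponds_to_surface_of_revolution g \<longleftrightarrow>
     (\<exists>l p q F. profile_curve l p q \<and>
        smooth_closed_surface (surface_of_revolution l p q) \<and>
        isometry_onto g (surface_of_revolution l p q) F \<and>
        (\<forall>\<theta>. \<forall>x\<in>S2. F (rot \<theta> x) = rot \<theta> (F x)))"

subsection \<open>Two flat discs glued along their boundary circles\<close>

text \<open>The points are pairs of a side and a point of the disc of radius \<open>r\<close>.  The distance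
  is the quotient (gluing) distance: the infimum of the total lengths of chains of jumps
  inside one disc, where switching sides at equal boundary points is free.\<close>

definition two_discs :: "real \<Rightarrow> (bool \<times> (real^2)) set" where
  "two_discs r = UNIV \<times> cball 0 r"

inductive disc_chain :: "real \<Rightarrow> bool \<times> (real^2) \<Rightarrow> bool \<times> (real^2) \<Rightarrow> real \<Rightarrow> bool"
  for r :: real where
  jump: "x \<in> cball 0 r \<Longrightarrow> y \<in> cball 0 r \<Longrightarrow> disc_chain r (s, x) (s, y) (dist x y)"
| switch: "x \<in> sphere 0 r \<Longrightarrow> disc_chain r (s, x) (s', x) 0"
| concat: "disc_chain r a b L \<Longrightarrow> disc_chain r b c L' \<Longrightarrow> disc_chain r a c (L + L')"

definition glued_dist :: "real \<Rightarrow> bool \<times> (real^2) \<Rightarrow> bool \<times> (real^2) \<Rightarrow> real" where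
  "glued_dist r a b = Inf {L. disc_chain r a b L}"

definition glued_discs_diameter :: "real \<Rightarrow> real" where
  "glued_discs_diameter r = Sup {glued_dist r a b | a b. a \<in> two_discs r \<and> b \<in> two_discs r}"

end

theory Submission
  imports Defs
begin

text \<open>Let \<open>R\<close> be the radius of the parallels of the metric and \<open>s\<close> the arclength measured
  orthogonally to the parallels, \<open>0 \<le> s \<le> l\<close>.  Every curve between the poles has length at least
  \<open>l\<close>, so the diameter is at least \<open>l\<close>, and the area is \<open>2 \<pi> \<integral> R ds\<close>.  For a surface in space, \<open>R\<close>
  is the distance from the axis, hence 1-Lipschitz in \<open>s\<close>, and it vanishes at both poles.  So
  \<open>R \<le> min s (l - s)\<close> and \<open>4 \<pi> < 2 \<pi> \<cdot> l\<^sup>2 / 4\<close>.\<close>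

subsection \<open>An integral inequality\<close>

text \<open>Rotation invariance allows a cross term between coordinate meridians and parallels, so
  the curves of constant longitude need be neither geodesic nor orthogonal to the parallels. Hence
  arclength is measured by \<open>colat_speed\<close>, the speed that remains after removing the
  component along the parallel: it bounds the length of every curve from below, and its product with
  the radius is the area density. Everything stays in the colatitude \<phi>; with
  \<open>E = colat_speed g\<close>, being 1-Lipschitz in the arclength reads
  \<open>\<bar>R'\<bar> \<le> E\<close>. The other obstacle is the poles: there \<open>E\<close>
  takes a default value, \<open>R\<close> has a corner, and the colatitude along a curve need not be
  differentiable. So derivatives, and continuity of \<open>E\<close>, are asked for only in the open
  interval, and continuity of the integrals up to the endpoints does the rest. The constant l^2/4 is
  the area under the tent with base l and slopes 1 and -1, which is the radius function of the
  doubled flat disc. Area 4 pi then gives l^2 > 8.\<close>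

lemma indefinite_integral_has_real_derivative:
  fixes f :: "real \<Rightarrow> real"
  assumes "f integrable_on {a..b}" "continuous_on {a<..<b} f" "a < x" "x < b"
  shows "((\<lambda>u. integral {a..u} f) has_real_derivative f x) (at x)"
proof -
  have "isCont f x"
    using assms continuous_on_interior[of "{a<..<b}" f x] by simp
  then have "((\<lambda>u. integral {a..u} f) has_vector_derivative f x) (at x within {a..b} - {})"
    using assms by (intro integral_has_vector_derivative_continuous_at)
      (auto intro: continuous_at_imp_continuous_at_within)
  moreover have "at x within {a..b} = at x"
    using assms by (intro at_within_interior) auto
  ultimately show ?thesis
    by (simp add: has_real_derivative_iff_has_vector_derivative)
qed

text \<open>With \<open>s\<close> the arclength, \<open>R \<le> min s (l - s)\<close>, and the integral of this minimum against
  \<open>ds\<close> is \<open>l\<^sup>2 / 4\<close>.  Equality is impossible because the minimum has a corner at the midpoint,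
  while \<open>R\<close> is differentiable there.\<close>

lemma integral_radius_less:
  fixes E R :: "real \<Rightarrow> real"
  assumes ab: "a < b" and intE: "E integrable_on {a..b}" and contE: "continuous_on {a<..<b} E"
    and pos: "\<And>x. a < x \<Longrightarrow> x < b \<Longrightarrow> 0 < E x"
    and contR: "continuous_on {a..b} R" and Ra: "R a = 0" and Rb: "R b = 0"
    and dR: "\<And>x. a < x \<Longrightarrow> x < b \<Longrightarrow> \<exists>D. (R has_real_derivative D) (at x) \<and> \<bar>D\<bar> \<le> E x"
    and intW: "(\<lambda>x. R x * E x) integrable_on {a..b}"
  shows "integral {a..b} (\<lambda>x. R x * E x) < (integral {a..b} E)\<^sup>2 / 4"
proof -
  define s where "s x = integral {a..x} E" for x
  define w where "w x = integral {a..x} (\<lambda>x. R x * E x)" for x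
  define l where "l = s b"
  have conts: "continuous_on {a..b} s" and contw: "continuous_on {a..b} w"
    unfolding s_def w_def using intE intW by (auto intro: indefinite_integral_continuous_1)
  have ds: "(s has_real_derivative E x) (at x)" if "a < x" "x < b" for x
    unfolding s_def using intE contE that by (rule indefinite_integral_has_real_derivative)
  have dw: "(w has_real_derivative R x * E x) (at x)" if "a < x" "x < b" for x
    unfolding w_def
    by (rule indefinite_integral_has_real_derivative[OF intW])
      (use that contE in \<open>auto intro!: continuous_on_mult intro: continuous_on_subset[OF contR]\<close>)
  have sa: "s a = 0" and wa: "w a = 0" by (simp_all add: s_def w_def)
  have Rs: "R x \<le> s x" if x: "a \<le> x" "x \<le> b" for x
  proof -
    have "s a - R a \<le> s x - R x"
    proof (rule DERIV_nonneg_imp_increasing_open[OF x(1)])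
      fix y assume y: "a < y" "y < x"
      then obtain D where "(R has_real_derivative D) (at y)" "\<bar>D\<bar> \<le> E y" using dR[of y] x by auto
      then show "\<exists>z. ((\<lambda>x. s x - R x) has_real_derivative z) (at y) \<and> 0 \<le> z"
        using ds[of y] x y by (intro exI[of _ "E y - D"]) (auto intro!: derivative_intros)
    qed (use x conts contR in \<open>auto intro!: continuous_on_diff intro: continuous_on_subset\<close>)
    then show ?thesis using sa Ra by simp
  qed
  have Rls: "R x \<le> l - s x" if x: "a \<le> x" "x \<le> b" for x
  proof -
    have "s x + R x \<le> s b + R b"
    proof (rule DERIV_nonneg_imp_increasing_open[OF x(2)])
      fix y assume y: "x < y" "y < b"
      then obtain D where "(R has_real_derivative D) (at y)" "\<bar>D\<bar> \<le> E y" using dR[of y] x by auto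
      then show "\<exists>z. ((\<lambda>x. s x + R x) has_real_derivative z) (at y) \<and> 0 \<le> z"
        using ds[of y] x y by (intro exI[of _ "E y + D"]) (auto intro!: derivative_intros)
    qed (use x conts contR in \<open>auto intro!: continuous_on_add intro: continuous_on_subset\<close>)
    then show ?thesis using Rb by (simp add: l_def)
  qed
  have "s a < s b"
    using ab ds pos conts by (intro DERIV_pos_imp_increasing_open[of a b s]) auto
  then have lpos: "0 < l" using sa by (simp add: l_def)
  \<comment> \<open>The point \<open>c\<close> is the midpoint in arclength, where the two bounds
    \<open>s\<close> and \<open>l - s\<close> cross.\<close>
  obtain c where c: "a \<le> c" "c \<le> b" "s c = l / 2"
    using IVT'[of s a "l / 2" b] sa lpos ab conts by (auto simp: l_def)
  then have ac: "a < c" and cb: "c < b"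
    using sa lpos by (auto simp: less_le l_def)
  \<comment> \<open>If \<open>R c\<close> reached l/2, both \<open>R - s\<close> (at most 0) and
    \<open>R + s\<close> (at most \<open>l\<close>) would attain their maximum at \<open>c\<close>.
    Then \<open>D - E c\<close> and \<open>D + E c\<close> both vanish, against
    \<open>E c > 0\<close>.\<close>
  have Rc: "R c < l / 2"
  proof (rule ccontr)
    assume "\<not> R c < l / 2"
    then have Rc: "R c = l / 2" using Rs[of c] c by simp
    obtain D where D: "(R has_real_derivative D) (at c)" using dR ac cb by blast
    have d0: "0 < min (c - a) (b - c)" using ac cb by simp
    have "D - E c = 0"
    proof (rule DERIV_local_max[OF _ d0])
      show "((\<lambda>x. R x - s x) has_real_derivative D - E c) (at c)"
        using D ds ac cb by (auto intro!: derivative_intros)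
      show "\<forall>y. \<bar>c - y\<bar> < min (c - a) (b - c) \<longrightarrow> R y - s y \<le> R c - s c"
        using Rs Rc c by (auto simp: abs_less_iff)
    qed
    moreover have "D + E c = 0"
    proof (rule DERIV_local_max[OF _ d0])
      show "((\<lambda>x. R x + s x) has_real_derivative D + E c) (at c)"
        using D ds ac cb by (auto intro!: derivative_intros)
      show "\<forall>y. \<bar>c - y\<bar> < min (c - a) (b - c) \<longrightarrow> R y + s y \<le> R c + s c"
      proof (intro allI impI)
        fix y assume "\<bar>c - y\<bar> < min (c - a) (b - c)"
        then show "R y + s y \<le> R c + s c" using Rls[of y] Rc c by (simp add: abs_less_iff)
      qed
    qed
    ultimately show False using pos[OF ac cb] by simp
  qed
  \<comment> \<open>The deficit of \<open>w\<close> against its upper bound: integrating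
    \<open>R \<le> s\<close> against \<open>ds\<close> gives \<open>s\<^sup>2 / 2\<close>.\<close>
  define k where "k x = (s x)\<^sup>2 / 2 - w x" for x
  have dk: "(k has_real_derivative E x * (s x - R x)) (at x)" if "a < x" "x < b" for x
    unfolding k_def using ds[OF that] dw[OF that]
    by (auto intro!: derivative_eq_intros simp: algebra_simps)
  have contk: "continuous_on {a..b} k"
    unfolding k_def by (auto intro!: continuous_intros conts contw)
  have k_nonneg: "0 \<le> k x" if x: "a \<le> x" "x \<le> b" for x
  proof -
    have "k a \<le> k x"
    proof (rule DERIV_nonneg_imp_increasing_open[OF x(1)])
      fix y assume "a < y" "y < x"
      then show "\<exists>z. (k has_real_derivative z) (at y) \<and> 0 \<le> z"
        using dk[of y] pos[of y] Rs[of y] x by (intro exI[of _ "E y * (s y - R y)"]) auto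
    qed (use x contk in \<open>auto intro: continuous_on_subset\<close>)
    then show ?thesis using sa wa by (simp add: k_def)
  qed
  have "0 < E c * (s c - R c)" using pos[OF ac cb] Rc c by simp
  then obtain d where d: "0 < d" "\<And>h. 0 < h \<Longrightarrow> h < d \<Longrightarrow> k (c - h) < k c"
    using DERIV_pos_inc_left[OF dk[OF ac cb]] by blast
  \<comment> \<open>The minimum with \<open>c - a\<close> keeps the comparison point in the
    interval, where \<open>k\<close> is nonnegative. So \<open>k c\<close> is strictly positive, and
    the strict inequality of the lemma comes from this half alone.\<close>
  have "k (c - min (d / 2) (c - a)) < k c" using d ac by (intro d(2)) auto
  moreover have "0 \<le> k (c - min (d / 2) (c - a))" using d ac cb by (intro k_nonneg) auto
  ultimately have w1: "w c < l\<^sup>2 / 8"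
    using c by (simp add: k_def power2_eq_square)
  \<comment> \<open>On the second half \<open>R \<le> l - s\<close> makes this sum nonincreasing, so
    at most another l^2/8 is added to \<open>w\<close>.\<close>
  have "w c + (l - s c)\<^sup>2 / 2 \<ge> w b + (l - s b)\<^sup>2 / 2"
  proof (rule DERIV_nonpos_imp_decreasing_open[OF c(2)])
    fix y assume y: "c < y" "y < b"
    have "((\<lambda>x. w x + (l - s x)\<^sup>2 / 2) has_real_derivative - (E y * (l - s y - R y))) (at y)"
      using ds[of y] dw[of y] y ac by (auto intro!: derivative_eq_intros simp: field_simps)
    moreover have "0 \<le> E y * (l - s y - R y)"
      using pos[of y] Rls[of y] y ac by simp
    ultimately show "\<exists>z. ((\<lambda>x. w x + (l - s x)\<^sup>2 / 2) has_real_derivative z) (at y) \<and> z \<le> 0"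
      by (intro exI[of _ "- (E y * (l - s y - R y))"]) auto
  qed (use c conts contw in \<open>auto intro!: continuous_intros intro: continuous_on_subset\<close>)
  then have "w b \<le> w c + l\<^sup>2 / 8" using c by (simp add: l_def power2_eq_square field_simps)
  with w1 have "w b < l\<^sup>2 / 4" by simp
  then show ?thesis by (simp add: w_def l_def s_def)
qed

subsection \<open>Continuity of smooth metrics\<close>

lemma Ck_on_const: "Ck_on k U (\<lambda>x. c)"
  by (induction k arbitrary: c) auto

lemma Ck_on_bounded_linear:
  assumes "bounded_linear f"
  shows "Ck_on k U f"
proof (cases k)
  case 0
  then show ?thesis using assms by (simp add: linear_continuous_on)
next
  case (Suc m)
  have der: "(f has_derivative f) (at x)" for x
    using assms by (rule bounded_linear_imp_has_derivative)
  then have "f differentiable (at x)" "frechet_derivative f (at x) = f" for x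
    using frechet_derivative_at[OF der] by (auto simp: differentiable_def)
  then show ?thesis using Suc by (simp add: Ck_on_const)
qed

text \<open>For unit \<open>x\<close> this is the orthogonal projection of \<open>u\<close> to the
  tangent plane at \<open>x\<close>. The projected basis vectors are globally smooth tangent fields
  that span every tangent plane; they stand in for a global frame, which the sphere does not
  admit.\<close>

definition tangential :: "real^3 \<Rightarrow> real^3 \<Rightarrow> real^3" where
  "tangential u x = u - (u \<bullet> x) *\<^sub>R x"

text \<open>The field is a constant plus a quadratic map in \<open>x\<close>, so each directional
  derivative is linear in \<open>x\<close> and the linear case finishes without induction.\<close>

lemma Ck_on_tangential: "Ck_on k U (tangential u)"
proof (cases k)
  case 0
  then show ?thesis unfolding tangential_def by (auto intro!: continuous_intros)
next
  case (Suc m)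
  have der: "(tangential u has_derivative (\<lambda>v. - ((u \<bullet> x) *\<^sub>R v + (u \<bullet> v) *\<^sub>R x))) (at x)" for x
    unfolding tangential_def by (auto intro!: derivative_eq_intros)
  then have "tangential u differentiable (at x)" for x
    by (auto simp: differentiable_def)
  moreover have "frechet_derivative (tangential u) (at x) v = - ((u \<bullet> x) *\<^sub>R v + (u \<bullet> v) *\<^sub>R x)" for x v
    by (simp add: frechet_derivative_at[OF der, symmetric])
  moreover have "bounded_linear (\<lambda>x. - ((u \<bullet> x) *\<^sub>R v + (u \<bullet> v) *\<^sub>R x))" for v
    by (intro bounded_linear_minus bounded_linear_add bounded_linear_scaleR_right
        bounded_linear_scaleR_const bounded_linear_inner_right bounded_linear_ident)
  ultimately show ?thesis using Suc by (simp add: Ck_on_bounded_linear)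
qed

lemma smooth_on_tangential: "smooth_on S (tangential u)"
  unfolding smooth_on_def using Ck_on_tangential by blast

lemma smooth_on_imp_continuous_on:
  assumes "smooth_on S f"
  shows "continuous_on S f"
  unfolding continuous_on_eq_continuous_within
proof
  fix x assume "x \<in> S"
  then obtain U h where U: "open U" "x \<in> U" "\<forall>k. Ck_on k U h" "\<forall>y\<in>S \<inter> U. h y = f y"
    using assms unfolding smooth_on_def by metis
  have "continuous_on U h" using spec[OF U(3), of 0] by simp
  then have "continuous_on (S \<inter> U) h" by (rule continuous_on_subset) simp
  then have "continuous_on (S \<inter> U) f" using U(4) by (auto intro: continuous_on_eq)
  then have "continuous (at x within S \<inter> U) f" using \<open>x \<in> S\<close> U
    by (simp add: continuous_on_eq_continuous_within)
  moreover have "at x within S \<inter> U = at x within S"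
    using U by (intro at_within_nhd[of x U]) auto
  ultimately show "continuous (at x within S) f" by simp
qed

lemma tangential_in_tangent_S2: "x \<in> S2 \<Longrightarrow> tangential u x \<in> tangent_S2 x"
  by (simp add: tangential_def tangent_S2_def inner_diff_left norm_eq_1)

lemma tangent_S2_0: "0 \<in> tangent_S2 x"
  and tangent_S2_add: "v \<in> tangent_S2 x \<Longrightarrow> w \<in> tangent_S2 x \<Longrightarrow> v + w \<in> tangent_S2 x"
  and tangent_S2_scaleR: "v \<in> tangent_S2 x \<Longrightarrow> a *\<^sub>R v \<in> tangent_S2 x"
  by (simp_all add: tangent_S2_def inner_add_left)

lemma tangent_S2_sum: "(\<And>i. i \<in> I \<Longrightarrow> p i \<in> tangent_S2 x) \<Longrightarrow> (\<Sum>i\<in>I. p i) \<in> tangent_S2 x"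
  by (induction I rule: infinite_finite_induct) (auto intro: tangent_S2_0 tangent_S2_add)

text \<open>Projection is linear in its first argument and fixes tangent vectors, so it can be
  applied to the expansion of \<open>v\<close> in the standard basis.\<close>

lemma tangent_S2_eq_sum_tangential:
  assumes "v \<in> tangent_S2 x"
  shows "v = (\<Sum>i\<in>Basis. (v \<bullet> i) *\<^sub>R tangential i x)"
proof -
  have "(\<Sum>i\<in>Basis. (v \<bullet> i) *\<^sub>R tangential i x) =
      (\<Sum>i\<in>Basis. (v \<bullet> i) *\<^sub>R i) - (\<Sum>i\<in>Basis. (v \<bullet> i) * (i \<bullet> x)) *\<^sub>R x"
    by (simp add: tangential_def algebra_simps sum_subtractf scaleR_left.sum)
  also have "(\<Sum>i\<in>Basis. (v \<bullet> i) * (i \<bullet> x)) = v \<bullet> x"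
    by (simp add: euclidean_inner[of v x] inner_commute)
  finally show ?thesis using assms by (simp add: euclidean_representation tangent_S2_def)
qed

context
  fixes g :: sphere_metric
  assumes smooth: "smooth_riemannian_metric g"
begin

lemma metric_lincomb_left:
  assumes "x \<in> S2" "u \<in> tangent_S2 x" "v \<in> tangent_S2 x" "w \<in> tangent_S2 x"
  shows "g x (a *\<^sub>R u + b *\<^sub>R v) w = a * g x u w + b * g x v w"
  using smooth assms unfolding smooth_riemannian_metric_def by blast

lemma metric_sym:
  assumes "x \<in> S2" "v \<in> tangent_S2 x" "w \<in> tangent_S2 x"
  shows "g x v w = g x w v"
  using smooth assms unfolding smooth_riemannian_metric_def by blast

lemma metric_pos:
  assumes "x \<in> S2" "v \<in> tangent_S2 x" "v \<noteq> 0"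
  shows "0 < g x v v"
  using smooth assms unfolding smooth_riemannian_metric_def by blast

lemma metric_lincomb_right:
  assumes "x \<in> S2" "u \<in> tangent_S2 x" "v \<in> tangent_S2 x" "w \<in> tangent_S2 x"
  shows "g x w (a *\<^sub>R u + b *\<^sub>R v) = a * g x w u + b * g x w v"
  using metric_lincomb_left[OF assms, of a b] metric_sym assms
  by (simp add: tangent_S2_add tangent_S2_scaleR)

lemma metric_zero_left: "x \<in> S2 \<Longrightarrow> w \<in> tangent_S2 x \<Longrightarrow> g x 0 w = 0"
  using metric_lincomb_left[of x 0 0 w 0 0] by (simp add: tangent_S2_0)

lemma metric_nonneg: "x \<in> S2 \<Longrightarrow> v \<in> tangent_S2 x \<Longrightarrow> 0 \<le> g x v v"
  using metric_pos[of x v] metric_zero_left[of x 0] by (cases "v = 0") (auto simp: tangent_S2_0)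

lemma metric_sum_left:
  assumes x: "x \<in> S2" and w: "w \<in> tangent_S2 x" and p: "\<And>i. i \<in> I \<Longrightarrow> p i \<in> tangent_S2 x"
  shows "g x (\<Sum>i\<in>I. c i *\<^sub>R p i) w = (\<Sum>i\<in>I. c i * g x (p i) w)"
  using p
proof (induction I rule: infinite_finite_induct)
  case (insert i I)
  have "g x (c i *\<^sub>R p i + 1 *\<^sub>R (\<Sum>i\<in>I. c i *\<^sub>R p i)) w =
      c i * g x (p i) w + 1 * g x (\<Sum>i\<in>I. c i *\<^sub>R p i) w"
    using x w insert by (intro metric_lincomb_left tangent_S2_sum tangent_S2_scaleR) auto
  then show ?case using insert by simp
qed (simp_all add: metric_zero_left[OF x w])

lemma metric_eq_sum_tangential:
  assumes x: "x \<in> S2" and v: "v \<in> tangent_S2 x" and w: "w \<in> tangent_S2 x"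
  shows "g x v w = (\<Sum>i\<in>Basis. \<Sum>j\<in>Basis.
    (v \<bullet> i) * ((w \<bullet> j) * g x (tangential i x) (tangential j x)))"
proof -
  note T = tangential_in_tangent_S2[OF x]
  have expand: "g x u u' = (\<Sum>i\<in>Basis. (u \<bullet> i) * g x (tangential i x) u')"
    if "u \<in> tangent_S2 x" "u' \<in> tangent_S2 x" for u u'
    using arg_cong[OF tangent_S2_eq_sum_tangential[OF that(1)], of "\<lambda>u. g x u u'"]
      metric_sum_left[OF x that(2) T, where c = "\<lambda>i. u \<bullet> i"] by (rule trans)
  have "g x v w = (\<Sum>i\<in>Basis. (v \<bullet> i) * g x (tangential i x) w)"
    using v w by (rule expand)
  also have "\<dots> = (\<Sum>i\<in>Basis. (v \<bullet> i) * g x w (tangential i x))"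
    by (simp only: metric_sym[OF x w T])
  also have "\<dots> = (\<Sum>i\<in>Basis. (v \<bullet> i) * (\<Sum>j\<in>Basis. (w \<bullet> j) * g x (tangential j x) (tangential i x)))"
    by (simp only: expand[OF w T])
  also have "\<dots> = (\<Sum>i\<in>Basis. \<Sum>j\<in>Basis.
      (v \<bullet> i) * ((w \<bullet> j) * g x (tangential j x) (tangential i x)))"
    by (simp only: sum_distrib_left)
  also have "\<dots> = (\<Sum>i\<in>Basis. \<Sum>j\<in>Basis.
      (v \<bullet> i) * ((w \<bullet> j) * g x (tangential i x) (tangential j x)))"
    by (intro sum.cong refl arg_cong2[where f = "(*)"] metric_sym x T)
  finally show ?thesis .
qed

text \<open>Smoothness of a metric is tested only on smooth tangent fields over the whole sphere,
  whereas here \<open>v\<close> and \<open>w\<close> are merely continuous along \<open>x\<close>.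
  Expanding them in the projected basis vectors leaves coefficients that are smooth on the
  sphere.\<close>

lemma continuous_on_metric:
  fixes x v w :: "'a::topological_space \<Rightarrow> real^3"
  assumes x: "continuous_on T x" and v: "continuous_on T v" and w: "continuous_on T w"
    and "\<And>t. t \<in> T \<Longrightarrow> x t \<in> S2" "\<And>t. t \<in> T \<Longrightarrow> v t \<in> tangent_S2 (x t)"
      "\<And>t. t \<in> T \<Longrightarrow> w t \<in> tangent_S2 (x t)"
  shows "continuous_on T (\<lambda>t. g (x t) (v t) (w t))"
proof -
  have G: "continuous_on T (\<lambda>t. g (x t) (tangential i (x t)) (tangential j (x t)))" for i j
  proof -
    have "smooth_on S2 (\<lambda>x. g x (tangential i x) (tangential j x))"
      using smooth smooth_on_tangential tangential_in_tangent_S2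
      unfolding smooth_riemannian_metric_def by blast
    from continuous_on_compose2[OF smooth_on_imp_continuous_on[OF this] x] show ?thesis
      using assms(4) by blast
  qed
  have "continuous_on T (\<lambda>t. \<Sum>i\<in>Basis. \<Sum>j\<in>Basis. (v t \<bullet> i) *
      ((w t \<bullet> j) * g (x t) (tangential i (x t)) (tangential j (x t))))"
    by (intro continuous_intros v w G)
  then show ?thesis
    using assms(4-6) metric_eq_sum_tangential by (simp cong: continuous_on_cong)
qed

text \<open>Tangent vectors of norm at most \<open>c\<close> form a compact set. The bound makes
  \<open>colat_speed\<close> integrable and the distances bounded above.\<close>

lemma metric_bounded:
  obtains B where "\<And>x v. x \<in> S2 \<Longrightarrow> v \<in> tangent_S2 x \<Longrightarrow> norm v \<le> c \<Longrightarrow> g x v v \<le> B"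
proof -
  let ?T = "S2 \<times> cball 0 c \<inter> {z. snd z \<bullet> fst z = 0}"
  have "compact ?T"
    by (intro compact_Int_closed compact_Times closed_Collect_eq continuous_intros) auto
  moreover have "continuous_on ?T (\<lambda>z. g (fst z) (snd z) (snd z))"
    by (intro continuous_on_metric continuous_intros) (auto simp: tangent_S2_def)
  ultimately have "bdd_above ((\<lambda>z. g (fst z) (snd z) (snd z)) ` ?T)"
    by (intro bounded_imp_bdd_above compact_imp_bounded compact_continuous_image)
  then obtain B where B: "\<And>z. z \<in> ?T \<Longrightarrow> g (fst z) (snd z) (snd z) \<le> B"
    by (auto simp: bdd_above_def)
  then show ?thesis using B[of "(_, _)"] by (intro that[of B]) (auto simp: tangent_S2_def)
qed

end

subsection \<open>Spherical coordinates\<close>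

lemma vector3_eq: "(vector [a, b, c] :: real^3) = a *\<^sub>R axis 1 1 + b *\<^sub>R axis 2 1 + c *\<^sub>R axis 3 1"
  by (simp add: vec_eq_iff forall_3 axis_def)

lemma has_vector_derivative_vector3:
  assumes "(a has_real_derivative a') F" "(b has_real_derivative b') F" "(c has_real_derivative c') F"
  shows "((\<lambda>t. vector [a t, b t, c t] :: real^3) has_vector_derivative vector [a', b', c']) F"
  unfolding vector3_eq
  by (intro has_vector_derivative_add bounded_linear.has_vector_derivative[OF bounded_linear_scaleR_left]
      assms[unfolded has_real_derivative_iff_has_vector_derivative])

lemma continuous_on_vector3:
  fixes a b c :: "'a::topological_space \<Rightarrow> real"
  assumes "continuous_on T a" "continuous_on T b" "continuous_on T c"
  shows "continuous_on T (\<lambda>t. vector [a t, b t, c t] :: real^3)"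
  unfolding vector3_eq by (intro continuous_intros assms)

lemma inner_real3: "(x :: real^3) \<bullet> y = x$1 * y$1 + x$2 * y$2 + x$3 * y$3"
  by (simp add: inner_vec_def sum_3)

definition sph_colat :: "real \<Rightarrow> real \<Rightarrow> real^3" where
  "sph_colat \<phi> \<theta> = vector [cos \<phi> * cos \<theta>, cos \<phi> * sin \<theta>, - sin \<phi>]"

definition sph_lon :: "real \<Rightarrow> real \<Rightarrow> real^3" where
  "sph_lon \<phi> \<theta> = vector [- (sin \<phi> * sin \<theta>), sin \<phi> * cos \<theta>, 0]"

lemma has_vector_derivative_sph:
  assumes "(p has_real_derivative p') (at t)" "(q has_real_derivative q') (at t)"
  shows "((\<lambda>t. sph (p t) (q t)) has_vector_derivative
    p' *\<^sub>R sph_colat (p t) (q t) + q' *\<^sub>R sph_lon (p t) (q t)) (at t)"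
proof -
  have "((\<lambda>t. sph (p t) (q t)) has_vector_derivative
      vector [cos (p t) * p' * cos (q t) + sin (p t) * (- sin (q t) * q'),
        cos (p t) * p' * sin (q t) + sin (p t) * (cos (q t) * q'), - sin (p t) * p']) (at t)"
    unfolding sph_def using assms
    by (intro has_vector_derivative_vector3) (auto intro!: derivative_eq_intros)
  also have "vector [cos (p t) * p' * cos (q t) + sin (p t) * (- sin (q t) * q'),
        cos (p t) * p' * sin (q t) + sin (p t) * (cos (q t) * q'), - sin (p t) * p'] =
      p' *\<^sub>R sph_colat (p t) (q t) + q' *\<^sub>R sph_lon (p t) (q t)"
    by (simp add: vec_eq_iff forall_3 sph_colat_def sph_lon_def algebra_simps)
  finally show ?thesis .
qed

lemma has_vector_derivative_sph_colat:
  "((\<lambda>s. sph s \<theta>) has_vector_derivative sph_colat \<phi> \<theta>) (at \<phi>)"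
  using has_vector_derivative_sph[of "\<lambda>s. s" 1 \<phi> "\<lambda>_. \<theta>" 0] by simp

lemma has_vector_derivative_sph_lon:
  "((\<lambda>s. sph \<phi> s) has_vector_derivative sph_lon \<phi> \<theta>) (at \<theta>)"
  using has_vector_derivative_sph[of "\<lambda>_. \<phi>" 0 \<theta> "\<lambda>s. s" 1] by simp

lemma continuous_on_sph:
  fixes p q :: "'a::t2_space \<Rightarrow> real"
  assumes "continuous_on T p" "continuous_on T q"
  shows "continuous_on T (\<lambda>t. sph (p t) (q t))"
    and "continuous_on T (\<lambda>t. sph_colat (p t) (q t))"
    and "continuous_on T (\<lambda>t. sph_lon (p t) (q t))"
  unfolding sph_def sph_colat_def sph_lon_def
  by (intro continuous_on_vector3 continuous_intros assms)+

lemma sin_cos_combine: "(sin \<phi> * cos \<theta>)\<^sup>2 + (sin \<phi> * sin \<theta>)\<^sup>2 = (sin \<phi>)\<^sup>2"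
  "(cos \<phi> * cos \<theta>)\<^sup>2 + (cos \<phi> * sin \<theta>)\<^sup>2 = (cos \<phi>)\<^sup>2" for \<phi> \<theta> :: real
  by (simp_all add: power_mult_distrib flip: distrib_left)

lemma sph_in_S2: "sph \<phi> \<theta> \<in> S2"
  using sin_cos_combine(1)[of \<phi> \<theta>]
  by (simp add: norm_eq_1 inner_real3 sph_def flip: power2_eq_square)

lemma norm_sph_colat: "norm (sph_colat \<phi> \<theta>) = 1"
  using sin_cos_combine(2)[of \<phi> \<theta>]
  by (simp add: norm_eq_1 inner_real3 sph_colat_def flip: power2_eq_square)

lemma norm_sph_lon: "norm (sph_lon \<phi> \<theta>) \<le> 1"
  using sin_cos_combine(1)[of \<phi> \<theta>] abs_square_le_1[of "sin \<phi>"] abs_sin_le_one[of \<phi>]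
  by (simp add: norm_le_square inner_real3 sph_lon_def flip: power2_eq_square)

lemma sph_colat_in_tangent_S2: "sph_colat \<phi> \<theta> \<in> tangent_S2 (sph \<phi> \<theta>)"
proof -
  have "cos \<phi> * cos \<theta> * (sin \<phi> * cos \<theta>) + cos \<phi> * sin \<theta> * (sin \<phi> * sin \<theta>) =
      cos \<phi> * sin \<phi> * ((sin \<theta>)\<^sup>2 + (cos \<theta>)\<^sup>2)"
    by algebra
  then show ?thesis
    by (simp add: tangent_S2_def inner_real3 sph_def sph_colat_def)
qed

lemma sph_lon_in_tangent_S2: "sph_lon \<phi> \<theta> \<in> tangent_S2 (sph \<phi> \<theta>)"
  by (simp add: tangent_S2_def inner_real3 sph_def sph_lon_def)

lemmas sph_tangent = sph_in_S2 sph_colat_in_tangent_S2 sph_lon_in_tangent_S2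

lemma rot_sph: "rot \<theta> (sph \<phi> 0) = sph \<phi> \<theta>" "rot \<theta> (sph_colat \<phi> 0) = sph_colat \<phi> \<theta>"
  "rot \<theta> (sph_lon \<phi> 0) = sph_lon \<phi> \<theta>"
  by (simp_all add: rot_def sph_def sph_colat_def sph_lon_def vec_eq_iff forall_3 mult.commute)

lemma S2_eq_sph:
  assumes "x \<in> S2"
  obtains \<theta> where "0 \<le> \<theta>" "\<theta> < 2 * pi" "x = sph (arccos (x $ 3)) \<theta>"
proof -
  have x: "(x$1)\<^sup>2 + (x$2)\<^sup>2 + (x$3)\<^sup>2 = 1"
    using assms by (simp add: norm_eq_1 inner_real3 flip: power2_eq_square)
  define r where "r = sqrt (1 - (x$3)\<^sup>2)"
  have "(x$3)\<^sup>2 \<le> 1" using x by (smt (verit) zero_le_power2)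
  then have x3: "\<bar>x$3\<bar> \<le> 1" and r2: "r\<^sup>2 = (x$1)\<^sup>2 + (x$2)\<^sup>2"
    using x by (simp_all add: r_def abs_square_le_1)
  then have sc: "sin (arccos (x$3)) = r" "cos (arccos (x$3)) = x$3"
    by (simp_all add: r_def sin_arccos_abs)
  obtain \<theta> where "0 \<le> \<theta>" "\<theta> < 2 * pi" "x$1 = r * cos \<theta>" "x$2 = r * sin \<theta>"
  proof (cases "r = 0")
    case True
    then show ?thesis using r2 that[of 0] by (simp add: sum_power2_eq_zero_iff)
  next
    case False
    have "(x$1 / r)\<^sup>2 + (x$2 / r)\<^sup>2 = r\<^sup>2 / r\<^sup>2"
      by (simp only: r2 power_divide add_divide_distrib)
    then have "(x$1 / r)\<^sup>2 + (x$2 / r)\<^sup>2 = 1"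
      using False by simp
    then show ?thesis using False that by (elim sincos_total_2pi) (simp add: field_simps)
  qed
  then show ?thesis
    using sc that by (simp add: vec_eq_iff forall_3 sph_def)
qed

text \<open>Only the first coefficient is made explicit: since the height is
  \<open>cos \<phi>\<close>, it is the rate at which \<open>v\<close> changes the colatitude, and
  later estimates discard the other one.\<close>

lemma tangent_S2_eq_sph_lincomb:
  assumes v: "v \<in> tangent_S2 (sph \<phi> \<theta>)" and "sin \<phi> \<noteq> 0"
  obtains b where "v = (- v$3 / sin \<phi>) *\<^sub>R sph_colat \<phi> \<theta> + b *\<^sub>R sph_lon \<phi> \<theta>"
proof -
  have "sin \<phi> * (v$1 * cos \<theta> + v$2 * sin \<theta>) = - v$3 * cos \<phi>"
    using v by (simp add: tangent_S2_def inner_real3 sph_def algebra_simps)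
  then have c: "(- v$3 / sin \<phi>) * cos \<phi> = v$1 * cos \<theta> + v$2 * sin \<theta>"
    using assms(2) by (simp add: field_simps)
  define b where "b = (v$2 * cos \<theta> - v$1 * sin \<theta>) / sin \<phi>"
  have b: "b * sin \<phi> = v$2 * cos \<theta> - v$1 * sin \<theta>"
    using assms(2) by (simp add: b_def)
  have "v$1 = (v$1 * cos \<theta> + v$2 * sin \<theta>) * cos \<theta> - (v$2 * cos \<theta> - v$1 * sin \<theta>) * sin \<theta>"
    "v$2 = (v$1 * cos \<theta> + v$2 * sin \<theta>) * sin \<theta> + (v$2 * cos \<theta> - v$1 * sin \<theta>) * cos \<theta>"
    using sin_cos_squared_add[of \<theta>] by algebra+
  then have "v = (- v$3 / sin \<phi>) *\<^sub>R sph_colat \<phi> \<theta> + b *\<^sub>R sph_lon \<phi> \<theta>"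
    unfolding c[symmetric] b[symmetric]
    using assms(2) by (simp add: vec_eq_iff forall_3 sph_colat_def sph_lon_def mult.assoc)
  then show ?thesis by (rule that)
qed

subsection \<open>Rotationally invariant metrics in spherical coordinates\<close>

text \<open>\<open>sph_lon\<close> is the velocity of the rotation, so for an invariant metric this
  is the circumference of the parallel divided by 2 pi. Longitude 0 represents all
  longitudes.\<close>

definition parallel_radius :: "sphere_metric \<Rightarrow> real \<Rightarrow> real" where
  "parallel_radius g \<phi> = sqrt (g (sph \<phi> 0) (sph_lon \<phi> 0) (sph_lon \<phi> 0))"

definition sph_gram :: "sphere_metric \<Rightarrow> real \<Rightarrow> real" where
  "sph_gram g \<phi> = g (sph \<phi> 0) (sph_colat \<phi> 0) (sph_colat \<phi> 0) *
     g (sph \<phi> 0) (sph_lon \<phi> 0) (sph_lon \<phi> 0) - (g (sph \<phi> 0) (sph_colat \<phi> 0) (sph_lon \<phi> 0))\<^sup>2"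

text \<open>The length, per unit of colatitude, of the component of the velocity orthogonal to the
  parallels.  At the poles the value is \<open>0\<close>, a division by \<open>0\<close>.\<close>

definition colat_speed :: "sphere_metric \<Rightarrow> real \<Rightarrow> real" where
  "colat_speed g \<phi> = sqrt (sph_gram g \<phi>) / parallel_radius g \<phi>"

context
  fixes g :: sphere_metric
  assumes smooth: "smooth_riemannian_metric g"
begin

lemma parallel_radius_squared: "(parallel_radius g \<phi>)\<^sup>2 = g (sph \<phi> 0) (sph_lon \<phi> 0) (sph_lon \<phi> 0)"
  using metric_nonneg[OF smooth sph_tangent(1,3)] by (simp add: parallel_radius_def)

lemma parallel_radius_pos:
  assumes "0 < \<phi>" "\<phi> < pi"
  shows "0 < parallel_radius g \<phi>"
proof -
  have "sph_lon \<phi> 0 $ 2 \<noteq> 0" using assms sin_gt_zero[of \<phi>] by (simp add: sph_lon_def)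
  then have "sph_lon \<phi> 0 \<noteq> 0" by (metis zero_index)
  then show ?thesis using metric_pos[OF smooth sph_tangent(1,3)] by (simp add: parallel_radius_def)
qed

lemma metric_sph_lincomb:
  "g (sph \<phi> \<theta>) (a *\<^sub>R sph_colat \<phi> \<theta> + b *\<^sub>R sph_lon \<phi> \<theta>) (a *\<^sub>R sph_colat \<phi> \<theta> + b *\<^sub>R sph_lon \<phi> \<theta>) =
    a\<^sup>2 * g (sph \<phi> \<theta>) (sph_colat \<phi> \<theta>) (sph_colat \<phi> \<theta>) +
    2 * a * b * g (sph \<phi> \<theta>) (sph_colat \<phi> \<theta>) (sph_lon \<phi> \<theta>) +
    b\<^sup>2 * g (sph \<phi> \<theta>) (sph_lon \<phi> \<theta>) (sph_lon \<phi> \<theta>)"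
proof -
  note t = sph_tangent[of \<phi> \<theta>]
  have T: "a *\<^sub>R sph_colat \<phi> \<theta> + b *\<^sub>R sph_lon \<phi> \<theta> \<in> tangent_S2 (sph \<phi> \<theta>)"
    using t by (intro tangent_S2_add tangent_S2_scaleR)
  show ?thesis
    using metric_sym[OF smooth t(1,3,2)]
    by (simp add: metric_lincomb_left[OF smooth t T] metric_lincomb_right[OF smooth t t(2)]
        metric_lincomb_right[OF smooth t t(3)] power2_eq_square algebra_simps)
qed

lemma sph_gram_pos:
  assumes "0 < \<phi>" "\<phi> < pi"
  shows "0 < sph_gram g \<phi>"
proof -
  let ?A = "g (sph \<phi> 0) (sph_colat \<phi> 0) (sph_colat \<phi> 0)"
  let ?B = "g (sph \<phi> 0) (sph_colat \<phi> 0) (sph_lon \<phi> 0)"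
  let ?C = "g (sph \<phi> 0) (sph_lon \<phi> 0) (sph_lon \<phi> 0)"
  \<comment> \<open>Up to the factor \<open>?C\<close>, this is the part of \<open>sph_colat\<close>
    orthogonal to \<open>sph_lon\<close>; its squared length is \<open>?C\<close> times the Gram
    determinant.\<close>
  let ?v = "?C *\<^sub>R sph_colat \<phi> 0 + (- ?B) *\<^sub>R sph_lon \<phi> 0"
  have C: "0 < ?C" using parallel_radius_pos[OF assms] by (simp add: parallel_radius_def)
  have "?v $ 3 \<noteq> 0" using assms sin_gt_zero[of \<phi>] C by (simp add: sph_colat_def sph_lon_def)
  then have "?v \<noteq> 0" by (metis zero_index)
  then have "0 < g (sph \<phi> 0) ?v ?v"
    by (intro metric_pos[OF smooth] sph_tangent tangent_S2_add tangent_S2_scaleR)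
  also have "\<dots> = ?C * sph_gram g \<phi>"
    unfolding metric_sph_lincomb by (simp add: sph_gram_def power2_eq_square algebra_simps)
  finally show ?thesis using C by (simp add: zero_less_mult_iff)
qed

lemma colat_speed_pos: "0 < \<phi> \<Longrightarrow> \<phi> < pi \<Longrightarrow> 0 < colat_speed g \<phi>"
  by (simp add: colat_speed_def sph_gram_pos parallel_radius_pos)

lemma parallel_radius_poles: "parallel_radius g 0 = 0" "parallel_radius g pi = 0"
proof -
  have "sph_lon 0 0 = 0" "sph_lon pi 0 = 0"
    by (simp_all add: sph_lon_def vec_eq_iff forall_3)
  then show "parallel_radius g 0 = 0" "parallel_radius g pi = 0"
    by (simp_all add: parallel_radius_def metric_zero_left[OF smooth sph_in_S2] tangent_S2_0)
qed

lemma colat_speed_nonneg: "\<phi> \<in> {0..pi} \<Longrightarrow> 0 \<le> colat_speed g \<phi>"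
  using colat_speed_pos[of \<phi>] parallel_radius_poles
  by (cases "\<phi> = 0 \<or> \<phi> = pi") (auto simp: colat_speed_def)

lemma continuous_on_parallel_radius: "continuous_on T (parallel_radius g)"
  unfolding parallel_radius_def
  by (intro continuous_on_real_sqrt continuous_on_metric[OF smooth] continuous_on_sph
      continuous_on_id continuous_on_const sph_tangent)

lemma continuous_on_sph_gram: "continuous_on T (sph_gram g)"
  unfolding sph_gram_def
  by (intro continuous_on_diff continuous_on_mult continuous_on_power continuous_on_metric[OF smooth]
      continuous_on_sph continuous_on_id continuous_on_const sph_tangent)

lemma continuous_on_colat_speed: "continuous_on {0<..<pi} (colat_speed g)"
  unfolding colat_speed_def
  using parallel_radius_pos
  by (intro continuous_on_divide continuous_on_real_sqrt continuous_on_sph_gram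
      continuous_on_parallel_radius) (force dest: parallel_radius_pos)

text \<open>Dropping the cross term gives \<open>(colat_speed g \<phi>)\<^sup>2 \<le> ?A\<close>,
  which is bounded on the sphere. Since the function need not be continuous at the poles,
  integrability comes from measurability and boundedness on the open interval.\<close>

lemma colat_speed_integrable: "colat_speed g integrable_on {0..pi}"
proof -
  obtain B where B: "\<And>x v. x \<in> S2 \<Longrightarrow> v \<in> tangent_S2 x \<Longrightarrow> norm v \<le> 1 \<Longrightarrow> g x v v \<le> B"
    using metric_bounded[OF smooth, of 1] by metis
  have bound: "norm (colat_speed g \<phi>) \<le> sqrt B" if "\<phi> \<in> {0<..<pi}" for \<phi>
  proof -
    have \<phi>: "0 < \<phi>" "\<phi> < pi" using that by auto
    let ?A = "g (sph \<phi> 0) (sph_colat \<phi> 0) (sph_colat \<phi> 0)"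
    have "sph_gram g \<phi> \<le> ?A * (parallel_radius g \<phi>)\<^sup>2"
      unfolding parallel_radius_squared by (simp add: sph_gram_def)
    then have "(colat_speed g \<phi>)\<^sup>2 \<le> ?A"
      using sph_gram_pos[OF \<phi>] parallel_radius_pos[OF \<phi>]
      by (simp add: colat_speed_def power_divide pos_divide_le_eq)
    also have "\<dots> \<le> B" by (intro B sph_tangent) (simp add: norm_sph_colat)
    finally show ?thesis using colat_speed_pos[OF \<phi>] by (simp add: real_le_rsqrt)
  qed
  have "(colat_speed g) integrable_on {0<..<pi}"
  proof (rule measurable_bounded_by_integrable_imp_integrable[OF _ _ bound])
    show "colat_speed g \<in> borel_measurable (lebesgue_on {0<..<pi})"
      by (intro continuous_imp_measurable_on_sets_lebesgue continuous_on_colat_speed) auto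
    show "(\<lambda>_. sqrt B) integrable_on {0<..<pi}"
      by (simp add: integrable_on_const)
  qed auto
  then show ?thesis by (simp add: integrable_on_open_interval_real)
qed

text \<open>At the poles both sides are 0 because \<open>sph_lon\<close> vanishes, so the area
  density is continuous up to the poles even where \<open>colat_speed\<close> is not.\<close>

lemma sqrt_sph_gram_eq:
  assumes "\<phi> \<in> {0..pi}"
  shows "sqrt (sph_gram g \<phi>) = parallel_radius g \<phi> * colat_speed g \<phi>"
proof (cases "\<phi> = 0 \<or> \<phi> = pi")
  case True
  then have "sph_lon \<phi> 0 = 0"
    by (auto simp: sph_lon_def vec_eq_iff forall_3)
  then have "sph_gram g \<phi> = 0"
    using metric_zero_left[OF smooth sph_tangent(1) tangent_S2_0]
      metric_zero_left[OF smooth sph_tangent(1,2)]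
      metric_sym[OF smooth sph_tangent, of \<phi> 0]
    by (simp add: sph_gram_def)
  then show ?thesis by (simp add: colat_speed_def)
next
  case False
  then show ?thesis using assms parallel_radius_pos[of \<phi>] by (auto simp: colat_speed_def)
qed

end

context
  fixes g :: sphere_metric
  assumes smooth: "smooth_riemannian_metric g" and inv: "S1_invariant g"
begin

lemma metric_sph_rot:
  "g (sph \<phi> \<theta>) (sph_colat \<phi> \<theta>) (sph_colat \<phi> \<theta>) = g (sph \<phi> 0) (sph_colat \<phi> 0) (sph_colat \<phi> 0)"
  "g (sph \<phi> \<theta>) (sph_colat \<phi> \<theta>) (sph_lon \<phi> \<theta>) = g (sph \<phi> 0) (sph_colat \<phi> 0) (sph_lon \<phi> 0)"
  "g (sph \<phi> \<theta>) (sph_lon \<phi> \<theta>) (sph_lon \<phi> \<theta>) = g (sph \<phi> 0) (sph_lon \<phi> 0) (sph_lon \<phi> 0)"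
proof -
  have "g (rot \<theta> (sph \<phi> 0)) (rot \<theta> v) (rot \<theta> w) = g (sph \<phi> 0) v w"
    if "v \<in> tangent_S2 (sph \<phi> 0)" "w \<in> tangent_S2 (sph \<phi> 0)" for v w
    using inv that sph_in_S2 unfolding S1_invariant_def by blast
  from this[OF sph_tangent(2,2)] this[OF sph_tangent(2,3)] this[OF sph_tangent(3,3)]
  show "g (sph \<phi> \<theta>) (sph_colat \<phi> \<theta>) (sph_colat \<phi> \<theta>) = g (sph \<phi> 0) (sph_colat \<phi> 0) (sph_colat \<phi> 0)"
    "g (sph \<phi> \<theta>) (sph_colat \<phi> \<theta>) (sph_lon \<phi> \<theta>) = g (sph \<phi> 0) (sph_colat \<phi> 0) (sph_lon \<phi> 0)"
    "g (sph \<phi> \<theta>) (sph_lon \<phi> \<theta>) (sph_lon \<phi> \<theta>) = g (sph \<phi> 0) (sph_lon \<phi> 0) (sph_lon \<phi> 0)"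
    by (simp_all add: rot_sph)
qed

text \<open>Completing the square splits \<open>?C * g x v v\<close> into
  \<open>a\<^sup>2 * sph_gram g \<phi>\<close> and a square coming from the component along the
  parallel, which is dropped. The second factor on the left is the derivative of
  \<open>arccos\<close> of the height in the direction \<open>v\<close>.\<close>

lemma colat_speed_le:
  assumes x: "x \<in> S2" and x3: "\<bar>x$3\<bar> < 1" and v: "v \<in> tangent_S2 x"
  shows "colat_speed g (arccos (x$3)) * (- v$3 / sqrt (1 - (x$3)\<^sup>2)) \<le> sqrt (g x v v)"
proof -
  define \<phi> where "\<phi> = arccos (x$3)"
  obtain \<theta> where xeq: "x = sph \<phi> \<theta>" using S2_eq_sph[OF x] unfolding \<phi>_def by blast
  have \<phi>: "0 < \<phi>" "\<phi> < pi" using x3 arccos_lt_bounded[of "x$3"] by (auto simp: \<phi>_def)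
  have s: "sin \<phi> = sqrt (1 - (x$3)\<^sup>2)" using x3 by (simp add: \<phi>_def sin_arccos_abs)
  obtain b where "v = (- v$3 / sin \<phi>) *\<^sub>R sph_colat \<phi> \<theta> + b *\<^sub>R sph_lon \<phi> \<theta>"
    using tangent_S2_eq_sph_lincomb[of v \<phi> \<theta>] v sin_gt_zero[OF \<phi>] xeq by auto
  then obtain a where a: "a = - v$3 / sin \<phi>" and veq: "v = a *\<^sub>R sph_colat \<phi> \<theta> + b *\<^sub>R sph_lon \<phi> \<theta>"
    by blast
  let ?B = "g (sph \<phi> 0) (sph_colat \<phi> 0) (sph_lon \<phi> 0)"
  let ?C = "g (sph \<phi> 0) (sph_lon \<phi> 0) (sph_lon \<phi> 0)"
  have C: "0 < ?C" using parallel_radius_pos[OF smooth \<phi>] by (simp add: parallel_radius_def)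
  have "?C * g x v v = a\<^sup>2 * sph_gram g \<phi> + (a * ?B + b * ?C)\<^sup>2"
    unfolding xeq veq metric_sph_lincomb[OF smooth] metric_sph_rot[of \<phi> \<theta>]
    by (simp add: sph_gram_def power2_eq_square algebra_simps)
  then have "a\<^sup>2 * sph_gram g \<phi> \<le> ?C * g x v v" by simp
  then have "(colat_speed g \<phi> * a)\<^sup>2 \<le> g x v v"
    using C sph_gram_pos[OF smooth \<phi>]
    by (simp add: colat_speed_def power_mult_distrib power_divide parallel_radius_squared[OF smooth]
        pos_divide_le_eq mult.commute)
  then show ?thesis
    using s a unfolding \<phi>_def[symmetric] by (intro real_le_rsqrt) simp
qed

lemma area_eq: "area g = 2 * pi * integral {0..pi} (\<lambda>\<phi>. parallel_radius g \<phi> * colat_speed g \<phi>)"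
proof -
  have gram: "g (sph \<phi> \<theta>) (sph_colat \<phi> \<theta>) (sph_colat \<phi> \<theta>) *
      g (sph \<phi> \<theta>) (sph_lon \<phi> \<theta>) (sph_lon \<phi> \<theta>) -
      (g (sph \<phi> \<theta>) (sph_colat \<phi> \<theta>) (sph_lon \<phi> \<theta>))\<^sup>2 = sph_gram g \<phi>" for \<phi> \<theta>
    by (simp only: sph_gram_def metric_sph_rot[of \<phi> \<theta>])
  have "area g = integral ({0..pi} \<times> {0..2*pi}) (\<lambda>z. sqrt (sph_gram g (fst z)))"
    unfolding area_def
    by (simp add: vector_derivative_at[OF has_vector_derivative_sph_colat]
        vector_derivative_at[OF has_vector_derivative_sph_lon] Let_def case_prod_unfold
        gram)
  also have "\<dots> = integral (cbox (0, 0) (pi, 2*pi)) (\<lambda>z. sqrt (sph_gram g (fst z)))"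
    by (simp add: cbox_Pair_eq)
  also have "\<dots> = integral (cbox 0 pi) (\<lambda>\<phi>. integral (cbox 0 (2*pi)) (\<lambda>\<theta>. sqrt (sph_gram g \<phi>)))"
    by (subst integral_prod_continuous)
      (auto intro!: continuous_on_real_sqrt continuous_on_compose2[OF continuous_on_sph_gram[OF smooth, of UNIV]]
        continuous_on_fst continuous_on_id)
  also have "\<dots> = integral {0..pi} (\<lambda>\<phi>. 2 * pi * (parallel_radius g \<phi> * colat_speed g \<phi>))"
    by (auto intro!: integral_cong simp: sqrt_sph_gram_eq[OF smooth])
  finally show ?thesis by simp
qed

end

subsection \<open>The radius of the parallels is 1-Lipschitz in the arclength\<close>

lemma has_vector_derivative_vec_nth:
  fixes f :: "real \<Rightarrow> real^'n"
  assumes "(f has_vector_derivative f') F"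
  shows "((\<lambda>t. f t $ i) has_real_derivative f' $ i) F"
  using bounded_linear.has_vector_derivative[OF bounded_linear_vec_nth assms]
  by (simp add: has_real_derivative_iff_has_vector_derivative)

text \<open>An isometry is differentiable only within the sphere; along a curve that stays there the
  composite still has a full derivative.\<close>

lemma has_vector_derivative_compose_within:
  assumes c: "(c has_vector_derivative c') (at t)" and S: "range c \<subseteq> S"
    and F: "(F has_derivative A) (at (c t) within S)"
  shows "((\<lambda>t. F (c t)) has_vector_derivative A c') (at t)"
proof -
  have "(F has_derivative A) (at (c t) within range c)"
    using F S by (rule has_derivative_subset)
  then have "(F \<circ> c has_derivative A \<circ> (\<lambda>h. h *\<^sub>R c')) (at t)"
    using c diff_chain_within[of c "\<lambda>h. h *\<^sub>R c'" t UNIV F A]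
    by (simp add: has_vector_derivative_def)
  moreover have "A (h *\<^sub>R c') = h *\<^sub>R A c'" for h
    using has_derivative_linear[OF F] by (rule linear_scale)
  ultimately show ?thesis
    by (simp add: has_vector_derivative_def comp_def)
qed

text \<open>The radius of a parallel is the distance of its image in space from the axis.\<close>

lemma parallel_radius_derivative_le:
  assumes smooth: "smooth_riemannian_metric g" and iso: "isometry_onto g M F"
    and equiv: "\<And>\<theta> x. x \<in> S2 \<Longrightarrow> F (rot \<theta> x) = rot \<theta> (F x)" and \<phi>: "0 < \<phi>" "\<phi> < pi"
  shows "\<exists>D. (parallel_radius g has_real_derivative D) (at \<phi>) \<and> \<bar>D\<bar> \<le> colat_speed g \<phi>"
proof -
  define f where "f s = F (sph s 0)" for s
  have "\<exists>A. (F has_derivative A) (at x within S2) \<and>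
      (\<forall>v\<in>tangent_S2 x. \<forall>w\<in>tangent_S2 x. g x v w = A v \<bullet> A w)" if "x \<in> S2" for x
    using iso that unfolding isometry_onto_def by blast
  then obtain A where A: "\<And>x. x \<in> S2 \<Longrightarrow> (F has_derivative A x) (at x within S2)"
    and gA: "\<And>x v w. x \<in> S2 \<Longrightarrow> v \<in> tangent_S2 x \<Longrightarrow> w \<in> tangent_S2 x \<Longrightarrow> g x v w = A x v \<bullet> A x w"
    by metis
  \<comment> \<open>Differentiating the equivariance in \<theta> at 0 shows that the differential
    carries \<open>sph_lon\<close> to the rotation velocity in space, whose norm is the distance
    from the axis.\<close>
  have lon: "A (sph s 0) (sph_lon s 0) = vector [- (f s $ 2), f s $ 1, 0]" for s
  proof -
    have 1: "((\<lambda>\<theta>. F (sph s \<theta>)) has_vector_derivative A (sph s 0) (sph_lon s 0)) (at 0)"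
      by (rule has_vector_derivative_compose_within[OF has_vector_derivative_sph_lon _ A])
        (rule sph_in_S2 image_subsetI)+
    have "F (sph s \<theta>) = rot \<theta> (f s)" for \<theta>
      using equiv[OF sph_in_S2, of \<theta> s 0] by (simp add: f_def rot_sph)
    moreover have "((\<lambda>\<theta>. rot \<theta> (f s)) has_vector_derivative vector [- (f s $ 2), f s $ 1, 0]) (at 0)"
      unfolding rot_def by (intro has_vector_derivative_vector3) (auto intro!: derivative_eq_intros)
    ultimately show ?thesis
      using vector_derivative_unique_at[OF 1] by simp
  qed
  define f' where "f' = A (sph \<phi> 0) (sph_colat \<phi> 0)"
  have "(f has_vector_derivative f') (at \<phi>)"
    unfolding f_def f'_def
    by (rule has_vector_derivative_compose_within[OF has_vector_derivative_sph_colat _ A])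
      (rule sph_in_S2 image_subsetI)+
  note df = has_vector_derivative_vec_nth[OF this]
  have radius: "parallel_radius g s = sqrt ((f s $ 1)\<^sup>2 + (f s $ 2)\<^sup>2)" for s
    using gA[OF sph_tangent(1,3,3)]
    by (simp add: parallel_radius_def lon inner_real3 power2_eq_square add.commute)
  define r where "r = parallel_radius g \<phi>"
  \<comment> \<open>Half the derivative of the squared distance from the axis, hence
    \<open>r\<close> times the derivative of the radius.\<close>
  define p where "p = f \<phi> $ 1 * f' $ 1 + f \<phi> $ 2 * f' $ 2"
  have r: "0 < r" using parallel_radius_pos[OF smooth \<phi>] by (simp add: r_def)
  then have r2: "0 < (f \<phi> $ 1)\<^sup>2 + (f \<phi> $ 2)\<^sup>2" by (simp add: r_def radius)
  have "((\<lambda>s. sqrt ((f s $ 1)\<^sup>2 + (f s $ 2)\<^sup>2)) has_real_derivative p / r) (at \<phi>)"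
    unfolding r_def radius p_def using r2
    by (auto intro!: derivative_eq_intros df simp: divide_simps)
  then have "(parallel_radius g has_real_derivative p / r) (at \<phi>)"
    by (simp only: radius[symmetric])
  moreover have "\<bar>p / r\<bar> \<le> colat_speed g \<phi>"
  proof -
    \<comment> \<open>Lagrange's identity in the horizontal plane: the squared inner product
      \<open>p\<close> and the squared cross term add up to the product of the squared lengths. What
      remains is the contribution of the vertical velocity.\<close>
    have "sph_gram g \<phi> = p\<^sup>2 + ((f \<phi> $ 1)\<^sup>2 + (f \<phi> $ 2)\<^sup>2) * (f' $ 3)\<^sup>2"
      using gA[OF sph_tangent(1,3,3), of \<phi> 0] gA[OF sph_tangent(1,2,3), of \<phi> 0]
        gA[OF sph_tangent(1,2,2), of \<phi> 0]
      by (simp add: sph_gram_def lon inner_real3 p_def flip: f'_def)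
        (simp add: power2_eq_square algebra_simps)
    then have "p\<^sup>2 \<le> sph_gram g \<phi>" by simp
    then have "\<bar>p\<bar> \<le> sqrt (sph_gram g \<phi>)" by (simp add: real_le_rsqrt)
    then show ?thesis using r by (simp add: colat_speed_def abs_divide divide_right_mono flip: r_def)
  qed
  ultimately show ?thesis by blast
qed

lemma integral_colat_speed_gt:
  assumes smooth: "smooth_riemannian_metric g" and inv: "S1_invariant g"
    and area: "area g = 4 * pi" and iso: "isometry_onto g M F"
    and equiv: "\<And>\<theta> x. x \<in> S2 \<Longrightarrow> F (rot \<theta> x) = rot \<theta> (F x)"
  shows "2 * sqrt 2 < integral {0..pi} (colat_speed g)"
proof -
  let ?l = "integral {0..pi} (colat_speed g)"
  have "(\<lambda>\<phi>. sqrt (sph_gram g \<phi>)) integrable_on {0..pi}"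
    by (intro integrable_continuous_real continuous_on_real_sqrt continuous_on_sph_gram smooth)
  then have "(\<lambda>\<phi>. parallel_radius g \<phi> * colat_speed g \<phi>) integrable_on {0..pi}"
    by (rule integrable_eq) (simp add: sqrt_sph_gram_eq[OF smooth])
  then have "integral {0..pi} (\<lambda>\<phi>. parallel_radius g \<phi> * colat_speed g \<phi>) < ?l\<^sup>2 / 4"
    using parallel_radius_derivative_le[OF smooth iso equiv]
    by (intro integral_radius_less colat_speed_integrable[OF smooth] colat_speed_pos[OF smooth]
        continuous_on_colat_speed[OF smooth] continuous_on_parallel_radius[OF smooth]
        parallel_radius_poles[OF smooth]) auto
  moreover have "integral {0..pi} (\<lambda>\<phi>. parallel_radius g \<phi> * colat_speed g \<phi>) = 2"
    using area_eq[OF smooth inv] area by simp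
  ultimately have "(2 * sqrt 2)\<^sup>2 < ?l\<^sup>2" by (simp add: power_mult_distrib)
  moreover have "0 \<le> ?l"
    by (intro integral_nonneg colat_speed_integrable colat_speed_nonneg smooth)
  ultimately show ?thesis by (rule power2_less_imp_less)
qed

subsection \<open>The distance between the poles\<close>

text \<open>Differentiating \<open>\<gamma> t \<bullet> \<gamma> t = 1\<close> makes the velocity
  orthogonal to the position. The endpoints join the exceptional set because the identity is known
  only inside the parameter interval, while the derivative is two-sided.\<close>

lemma valid_path_S2_velocity:
  assumes vp: "valid_path \<gamma>" and im: "path_image \<gamma> \<subseteq> S2"
  obtains S where "finite S"
    "\<And>t. t \<in> {0..1} - S \<Longrightarrow> (\<gamma> has_vector_derivative vector_derivative \<gamma> (at t)) (at t)"
    "\<And>t. t \<in> {0..1} - S \<Longrightarrow> vector_derivative \<gamma> (at t) \<in> tangent_S2 (\<gamma> t)"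
proof -
  obtain S where S: "finite S" "\<gamma> C1_differentiable_on {0..1} - S"
    using vp unfolding valid_path_def piecewise_C1_differentiable_on_def by blast
  have reg: "(\<gamma> has_vector_derivative vector_derivative \<gamma> (at t)) (at t) \<and>
      vector_derivative \<gamma> (at t) \<in> tangent_S2 (\<gamma> t)" if t: "t \<in> {0..1} - (S \<union> {0, 1})" for t
  proof -
    have d: "(\<gamma> has_vector_derivative vector_derivative \<gamma> (at t)) (at t)"
      using S(2) t unfolding C1_differentiable_on_eq by (simp add: vector_derivative_works)
    have "((\<lambda>t. \<gamma> t \<bullet> \<gamma> t) has_derivative
        (\<lambda>h. \<gamma> t \<bullet> (h *\<^sub>R vector_derivative \<gamma> (at t)) + (h *\<^sub>R vector_derivative \<gamma> (at t)) \<bullet> \<gamma> t)) (at t)"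
      using d unfolding has_vector_derivative_def by (intro has_derivative_inner)
    also have "(\<lambda>h. \<gamma> t \<bullet> (h *\<^sub>R vector_derivative \<gamma> (at t)) + (h *\<^sub>R vector_derivative \<gamma> (at t)) \<bullet> \<gamma> t) =
        (*) (2 * (vector_derivative \<gamma> (at t) \<bullet> \<gamma> t))"
      by (simp add: fun_eq_iff inner_commute[of "\<gamma> t"])
    finally have "((\<lambda>t. \<gamma> t \<bullet> \<gamma> t) has_real_derivative 2 * (vector_derivative \<gamma> (at t) \<bullet> \<gamma> t)) (at t)"
      by (simp only: has_field_derivative_def)
    moreover have "((\<lambda>t. \<gamma> t \<bullet> \<gamma> t) has_real_derivative 0) (at t)"
    proof (rule has_field_derivative_transform_within_open[where f = "\<lambda>_. 1" and S = "{0<..<1}"])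
      fix u :: real assume "u \<in> {0<..<1}"
      then have "\<gamma> u \<in> S2" using im unfolding path_image_def by fastforce
      then show "1 = \<gamma> u \<bullet> \<gamma> u" by (simp add: norm_eq_1)
    qed (use t in auto)
    ultimately have "2 * (vector_derivative \<gamma> (at t) \<bullet> \<gamma> t) = 0" by (rule DERIV_unique)
    then show ?thesis using d by (simp add: tangent_S2_def)
  qed
  then show ?thesis using S(1) that[of "S \<union> {0, 1}"] by blast
qed

text \<open>The value at the exceptional points has to be replaced: there the velocity need not be
  tangent, and the root of a negative number is negative.\<close>

lemma curve_has_length_spike:
  assumes smooth: "smooth_riemannian_metric g" and im: "path_image \<gamma> \<subseteq> S2"
    and len: "curve_has_length g \<gamma> L" and S: "finite S"
    and tangent: "\<And>t. t \<in> {0..1} - S \<Longrightarrow> vector_derivative \<gamma> (at t) \<in> tangent_S2 (\<gamma> t)"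
  defines "m \<equiv> \<lambda>t. if t \<in> S then 0
    else sqrt (g (\<gamma> t) (vector_derivative \<gamma> (at t)) (vector_derivative \<gamma> (at t)))"
  shows "(m has_integral L) {0..1}" and "\<And>t. t \<in> {0..1} \<Longrightarrow> 0 \<le> m t"
proof -
  show "(m has_integral L) {0..1}"
    using has_integral_spike_finite[OF S _ len[unfolded curve_has_length_def Let_def], of m]
    by (simp add: m_def)
  fix t :: real assume t: "t \<in> {0..1}"
  then have "\<gamma> t \<in> S2" using im unfolding path_image_def by blast
  then show "0 \<le> m t" using metric_nonneg[OF smooth _ tangent, of t] t by (simp add: m_def)
qed

lemma curve_has_length_nonneg:
  assumes smooth: "smooth_riemannian_metric g" and vp: "valid_path \<gamma>" and im: "path_image \<gamma> \<subseteq> S2"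
    and len: "curve_has_length g \<gamma> L"
  shows "0 \<le> L"
proof -
  obtain S where S: "finite S"
    "\<And>t. t \<in> {0..1} - S \<Longrightarrow> vector_derivative \<gamma> (at t) \<in> tangent_S2 (\<gamma> t)"
    using valid_path_S2_velocity[OF vp im] by metis
  show ?thesis
    using has_integral_nonneg[OF curve_has_length_spike[OF smooth im len S]] .
qed

text \<open>The curve is only followed from its last visit to the starting pole to the next visit to
  the other pole, since colatitude is not differentiable at the poles.\<close>

lemma pole_to_pole_length:
  assumes smooth: "smooth_riemannian_metric g" and inv: "S1_invariant g"
    and vp: "valid_path \<gamma>" and im: "path_image \<gamma> \<subseteq> S2"
    and start: "pathstart \<gamma> = sph 0 0" and finish: "pathfinish \<gamma> = sph pi 0"
    and len: "curve_has_length g \<gamma> L"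
  shows "integral {0..pi} (colat_speed g) \<le> L"
proof -
  define z where "z t = \<gamma> t $ 3" for t
  have \<gamma>S2: "\<gamma> t \<in> S2" if "t \<in> {0..1}" for t using im that unfolding path_image_def by blast
  have z_le: "\<bar>z t\<bar> \<le> 1" if "t \<in> {0..1}" for t
    using \<gamma>S2[OF that] component_le_norm_cart[of "\<gamma> t" 3] by (simp add: z_def)
  have "continuous_on {0..1} \<gamma>" using valid_path_imp_path[OF vp] by (simp add: path_def)
  then have contz: "continuous_on {0..1} z" unfolding z_def by (intro continuous_intros)
  have z01: "z 0 = 1" "z 1 = -1"
    using start finish by (simp_all add: z_def pathstart_def pathfinish_def sph_def)
  obtain t0 where t0: "t0 \<in> {0..1}" "z t0 = 1" and last: "\<And>t. t \<in> {0..1} \<Longrightarrow> z t = 1 \<Longrightarrow> t \<le> t0"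
  proof -
    have "closed {t \<in> {0..1}. z t = 1}"
      using contz by (intro continuous_closed_preimage_constant) auto
    moreover have "bounded {t \<in> {0..1}. z t = 1}"
      by (rule bounded_subset[OF bounded_closed_interval[of 0 1]]) auto
    ultimately have "compact {t \<in> {0..1}. z t = 1}"
      by (simp add: compact_eq_bounded_closed)
    then show ?thesis
      using compact_attains_sup[of "{t \<in> {0..1}. z t = 1}"] z01 that by force
  qed
  obtain t1 where t1: "t1 \<in> {t0..1}" "z t1 = -1" and first: "\<And>t. t \<in> {t0..1} \<Longrightarrow> z t = -1 \<Longrightarrow> t1 \<le> t"
  proof -
    have "closed {t \<in> {t0..1}. z t = -1}"
      using t0 continuous_on_subset[OF contz] by (intro continuous_closed_preimage_constant) auto
    moreover have "bounded {t \<in> {t0..1}. z t = -1}"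
      by (rule bounded_subset[OF bounded_closed_interval[of t0 1]]) auto
    ultimately have "compact {t \<in> {t0..1}. z t = -1}"
      by (simp add: compact_eq_bounded_closed)
    then show ?thesis
      using compact_attains_inf[of "{t \<in> {t0..1}. z t = -1}"] z01 t0 that by force
  qed
  have t01: "{t0..t1} \<subseteq> {0..1}" "t0 \<le> t1" using t0 t1 by auto
  \<comment> \<open>After \<open>t0\<close> the curve avoids the starting pole, and before
    \<open>t1\<close> it avoids the other one.\<close>
  have inner: "\<bar>z t\<bar> < 1" if "t \<in> {t0<..<t1}" for t
    using z_le[of t] last[of t] first[of t] that t0 t1 by (fastforce simp: abs_le_iff)
  define s where "s \<phi> = integral {0..\<phi>} (colat_speed g)" for \<phi>
  obtain S where S: "finite S" and reg: "\<And>t. t \<in> {0..1} - S \<Longrightarrow>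
      (\<gamma> has_vector_derivative vector_derivative \<gamma> (at t)) (at t)"
      "\<And>t. t \<in> {0..1} - S \<Longrightarrow> vector_derivative \<gamma> (at t) \<in> tangent_S2 (\<gamma> t)"
    using valid_path_S2_velocity[OF vp im] by metis
  define m where "m = (\<lambda>t. if t \<in> S then 0
    else sqrt (g (\<gamma> t) (vector_derivative \<gamma> (at t)) (vector_derivative \<gamma> (at t))))"
  have m: "(m has_integral L) {0..1}"
    unfolding m_def by (rule curve_has_length_spike(1)[OF smooth im len S reg(2)])
  have m_nonneg: "0 \<le> m t" if "t \<in> {0..1}" for t
    unfolding m_def by (rule curve_has_length_spike(2)[OF smooth im len S reg(2) that])
  \<comment> \<open>The orthogonal arclength from the starting pole to the current parallel; it
    grows from 0 at \<open>t0\<close> to the full integral at \<open>t1\<close>.\<close>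
  define H where "H t = s (arccos (z t))" for t
  \<comment> \<open>The value 0 at the exceptional times keeps \<open>H'\<close> below the
    nonnegative \<open>m\<close>. At \<open>t0\<close> and \<open>t1\<close> the root in the
    denominator vanishes.\<close>
  define H' where "H' t = (if t \<in> S \<union> {t0, t1} then 0 else
    colat_speed g (arccos (z t)) * (- vector_derivative \<gamma> (at t) $ 3 / sqrt (1 - (z t)\<^sup>2)))" for t
  have "(H' has_integral H t1 - H t0) {t0..t1}"
  proof (rule fundamental_theorem_of_calculus_interior_strong[OF S t01(2)])
    fix t assume t: "t \<in> {t0<..<t1} - S"
    then have zt: "\<bar>z t\<bar> < 1" and t': "t \<in> {0..1} - S" using inner t01 by auto
    have "(z has_real_derivative vector_derivative \<gamma> (at t) $ 3) (at t)"
      unfolding z_def by (rule has_vector_derivative_vec_nth[OF reg(1)[OF t']])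
    moreover have "(s has_real_derivative colat_speed g (arccos (z t))) (at (arccos (z t)))"
      unfolding s_def using zt arccos_lt_bounded[of "z t"]
      by (intro indefinite_integral_has_real_derivative[OF colat_speed_integrable[OF smooth]
          continuous_on_colat_speed[OF smooth]]) auto
    ultimately have "(H has_real_derivative colat_speed g (arccos (z t)) *
        (inverse (- sqrt (1 - (z t)\<^sup>2)) * vector_derivative \<gamma> (at t) $ 3)) (at t)"
      unfolding H_def using zt by (intro DERIV_chain2[of s] DERIV_chain2[of arccos] DERIV_arccos) auto
    then show "(H has_vector_derivative H' t) (at t)"
      using t by (simp add: H'_def has_real_derivative_iff_has_vector_derivative divide_inverse mult.commute)
  next
    have "continuous_on {0..pi} s"
      unfolding s_def using colat_speed_integrable[OF smooth] by (rule indefinite_integral_continuous_1)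
    moreover have "continuous_on {t0..t1} (\<lambda>t. arccos (z t))"
      using z_le t01 continuous_on_subset[OF contz t01(1)]
      by (intro continuous_on_arccos) (auto simp: abs_le_iff)
    ultimately show "continuous_on {t0..t1} H"
      unfolding H_def
    proof (rule continuous_on_compose2)
      show "(\<lambda>t. arccos (z t)) ` {t0..t1} \<subseteq> {0..pi}"
        using z_le t01 arccos_bounded by (auto simp: abs_le_iff)
    qed
  qed
  moreover have "(m has_integral integral {t0..t1} m) {t0..t1}"
    using m t01 by (meson has_integral_integrable integrable_on_subinterval integrable_integral)
  moreover have "H' t \<le> m t" if "t \<in> {t0..t1}" for t
  proof (cases "t \<in> S \<union> {t0, t1}")
    case True
    then show ?thesis using m_nonneg that t01 by (auto simp: H'_def)
  next
    case False
    then have t: "t \<in> {0..1} - S" "t \<in> {t0<..<t1}" using that t01 by auto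
    then show ?thesis
      using colat_speed_le[OF smooth inv \<gamma>S2 _ reg(2), of t] inner[OF t(2)] False
      by (simp add: H'_def m_def z_def)
  qed
  ultimately have "H t1 - H t0 \<le> integral {t0..t1} m" by (rule has_integral_le)
  also have "\<dots> \<le> integral {0..1} m"
    using m m_nonneg t01 by (intro integral_subset_le)
      (auto intro: has_integral_integrable integrable_on_subinterval)
  also have "\<dots> = L" using m by (rule integral_unique)
  also have "H t1 - H t0 = integral {0..pi} (colat_speed g)"
    using t0 t1 by (simp add: H_def s_def)
  finally show ?thesis .
qed

subsection \<open>The diameter\<close>

text \<open>A segment in the coordinate rectangle joins any two points with Euclidean speed at most
  pi + 2 pi. The resulting length bound is uniform, as needed for a meaningful infimum and supremum
  in the definition of the diameter.\<close>

lemma sph_path: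
  fixes \<phi> \<phi>' \<theta> \<theta>' :: real
  assumes smooth: "smooth_riemannian_metric g"
  defines "\<gamma> \<equiv> \<lambda>t. sph (\<phi> + t * (\<phi>' - \<phi>)) (\<theta> + t * (\<theta>' - \<theta>))"
  assumes bound: "\<And>x v. x \<in> S2 \<Longrightarrow> v \<in> tangent_S2 x \<Longrightarrow> norm v \<le> 3 * pi \<Longrightarrow> g x v v \<le> B"
    and range: "\<bar>\<phi>' - \<phi>\<bar> \<le> pi" "\<bar>\<theta>' - \<theta>\<bar> \<le> 2 * pi"
  shows "\<exists>L. valid_path \<gamma> \<and> path_image \<gamma> \<subseteq> S2 \<and> pathstart \<gamma> = sph \<phi> \<theta> \<and>
    pathfinish \<gamma> = sph \<phi>' \<theta>' \<and> curve_has_length g \<gamma> L \<and> L \<le> sqrt B"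
proof -
  define p where "p t = \<phi> + t * (\<phi>' - \<phi>)" for t
  define q where "q t = \<theta> + t * (\<theta>' - \<theta>)" for t
  define v where "v t = (\<phi>' - \<phi>) *\<^sub>R sph_colat (p t) (q t) + (\<theta>' - \<theta>) *\<^sub>R sph_lon (p t) (q t)" for t
  have \<gamma>: "\<gamma> = (\<lambda>t. sph (p t) (q t))" by (simp add: \<gamma>_def p_def q_def)
  have cont: "continuous_on T p" "continuous_on T q" for T
    unfolding p_def q_def by (intro continuous_intros)+
  have v: "(\<gamma> has_vector_derivative v t) (at t)" for t
    unfolding \<gamma> v_def by (rule has_vector_derivative_sph)
      (auto simp: p_def q_def intro!: derivative_eq_intros)
  have contv: "continuous_on T v" for T
    unfolding v_def by (intro continuous_intros continuous_on_sph cont)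
  have vT: "v t \<in> tangent_S2 (\<gamma> t)" for t
    unfolding v_def \<gamma> by (intro tangent_S2_add tangent_S2_scaleR sph_tangent)
  have \<gamma>S2: "\<gamma> t \<in> S2" for t unfolding \<gamma> by (rule sph_in_S2)
  have normv: "norm (v t) \<le> 3 * pi" for t
  proof -
    have "norm (v t) \<le> \<bar>\<phi>' - \<phi>\<bar> * 1 + \<bar>\<theta>' - \<theta>\<bar> * norm (sph_lon (p t) (q t))"
      unfolding v_def by (rule norm_triangle_le) (simp add: norm_sph_colat)
    also have "\<dots> \<le> pi * 1 + 2 * pi * 1"
      using range norm_sph_lon by (intro add_mono mult_mono) auto
    finally show ?thesis by simp
  qed
  let ?l = "\<lambda>t. sqrt (g (\<gamma> t) (v t) (v t))"
  have contl: "continuous_on {0..1} ?l"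
  proof -
    have "continuous_on {0..1} \<gamma>" unfolding \<gamma> by (intro continuous_on_sph cont)
    then show ?thesis
      by (intro continuous_on_real_sqrt continuous_on_metric[OF smooth] contv \<gamma>S2 vT)
  qed
  have len: "curve_has_length g \<gamma> (integral {0..1} ?l)"
    unfolding curve_has_length_def Let_def vector_derivative_at[OF v]
    by (intro integrable_integral integrable_continuous_real contl)
  have "integral {0..1} ?l \<le> integral {0..1} (\<lambda>_::real. sqrt B)"
    using bound[OF \<gamma>S2 vT normv]
    by (intro integral_le integrable_continuous_real contl) auto
  then have "integral {0..1} ?l \<le> sqrt B" by simp
  moreover have "valid_path \<gamma>"
    unfolding valid_path_def
    by (intro C1_differentiable_imp_piecewise) (use v contv in \<open>auto simp: C1_differentiable_on_def\<close>)
  moreover have "path_image \<gamma> \<subseteq> S2" unfolding path_image_def using \<gamma>S2 by (rule image_subsetI)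
  moreover have "pathstart \<gamma> = sph \<phi> \<theta>" "pathfinish \<gamma> = sph \<phi>' \<theta>'"
    by (simp_all add: \<gamma>_def pathstart_def pathfinish_def)
  ultimately show ?thesis using len by blast
qed

lemma riemannian_diameter_ge:
  assumes smooth: "smooth_riemannian_metric g" and inv: "S1_invariant g"
  shows "integral {0..pi} (colat_speed g) \<le> riemannian_diameter g"
proof -
  let ?lengths = "\<lambda>x y. {L. \<exists>\<gamma>. valid_path \<gamma> \<and> path_image \<gamma> \<subseteq> S2 \<and>
     pathstart \<gamma> = x \<and> pathfinish \<gamma> = y \<and> curve_has_length g \<gamma> L}"
  obtain B where B: "\<And>x v. x \<in> S2 \<Longrightarrow> v \<in> tangent_S2 x \<Longrightarrow> norm v \<le> 3 * pi \<Longrightarrow> g x v v \<le> B"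
    using metric_bounded[OF smooth, of "3 * pi"] by metis
  have ex: "\<exists>L\<in>?lengths x y. L \<le> sqrt B" if x: "x \<in> S2" and y: "y \<in> S2" for x y
  proof -
    obtain \<theta> where \<theta>: "0 \<le> \<theta>" "\<theta> < 2 * pi" "x = sph (arccos (x $ 3)) \<theta>" using S2_eq_sph[OF x] .
    obtain \<theta>' where \<theta>': "0 \<le> \<theta>'" "\<theta>' < 2 * pi" "y = sph (arccos (y $ 3)) \<theta>'" using S2_eq_sph[OF y] .
    have "\<bar>x $ 3\<bar> \<le> 1" "\<bar>y $ 3\<bar> \<le> 1"
      using component_le_norm_cart[of x 3] component_le_norm_cart[of y 3] x y by simp_all
    then have "\<bar>arccos (y $ 3) - arccos (x $ 3)\<bar> \<le> pi"
      using arccos_bounded[of "x $ 3"] arccos_bounded[of "y $ 3"] by (auto simp: abs_le_iff)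
    moreover have "\<bar>\<theta>' - \<theta>\<bar> \<le> 2 * pi" using \<theta> \<theta>' by auto
    ultimately show ?thesis
      using sph_path[OF smooth B, of "arccos (y $ 3)" "arccos (x $ 3)" \<theta>' \<theta>] \<theta>(3) \<theta>'(3) by auto
  qed
  have "riemannian_dist g x y \<le> sqrt B" if "x \<in> S2" "y \<in> S2" for x y
  proof -
    obtain L where L: "L \<in> ?lengths x y" "L \<le> sqrt B" using ex \<open>x \<in> S2\<close> \<open>y \<in> S2\<close> by meson
    have "bdd_below (?lengths x y)"
      using curve_has_length_nonneg[OF smooth] by (intro bdd_belowI[of _ 0]) blast
    with L show ?thesis unfolding riemannian_dist_def by (meson cInf_lower order_trans)
  qed
  then have "bdd_above {riemannian_dist g x y | x y. x \<in> S2 \<and> y \<in> S2}"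
    by (intro bdd_aboveI[of _ "sqrt B"]) blast
  then have "riemannian_dist g (sph 0 0) (sph pi 0) \<le> riemannian_diameter g"
    unfolding riemannian_diameter_def using sph_in_S2 by (intro cSup_upper) blast+
  moreover have "integral {0..pi} (colat_speed g) \<le> riemannian_dist g (sph 0 0) (sph pi 0)"
    unfolding riemannian_dist_def
  proof (rule cInf_greatest)
    show "?lengths (sph 0 0) (sph pi 0) \<noteq> {}" using ex[OF sph_in_S2 sph_in_S2] by blast
    show "\<And>L. L \<in> ?lengths (sph 0 0) (sph pi 0) \<Longrightarrow> integral {0..pi} (colat_speed g) \<le> L"
      using pole_to_pole_length[OF smooth inv] by blast
  qed
  ultimately show ?thesis by linarith
qed

subsection \<open>The glued discs\<close>

lemma measure_cball_real2_eq_iff: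
  "measure lebesgue (cball (0 :: real^2) r) = 2 * pi \<longleftrightarrow> r = sqrt 2"
proof (cases "r \<ge> 0")
  case True
  then have "measure lebesgue (cball (0 :: real^2) r) = pi * r\<^sup>2"
    using content_cball[of r "0 :: real^2"] unit_ball_vol_2 by simp
  then show ?thesis using True by (auto simp: real_sqrt_unique)
next
  case False
  \<comment> \<open>A negative radius gives the empty ball, of measure 0.\<close>
  then show ?thesis by (auto simp: not_le)
qed

lemma disc_chain_nonneg: "disc_chain r a b L \<Longrightarrow> 0 \<le> L"
  by (induction rule: disc_chain.induct) auto

text \<open>The function \<open>\<plusminus>(r - norm x)\<close>, with the sign given by the side, is well defined on the glued
  space and 1-Lipschitz.\<close>

lemma disc_chain_ge:
  assumes "disc_chain r a b L"
  shows "(if fst b then r - norm (snd b) else norm (snd b) - r) -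
    (if fst a then r - norm (snd a) else norm (snd a) - r) \<le> L"
  using assms
proof (induction rule: disc_chain.induct)
  case (jump x y s)
  then show ?case
    using norm_triangle_ineq2[of x y] norm_triangle_ineq2[of y x]
    by (auto simp: dist_norm norm_minus_commute)
qed auto

lemma exists_sphere_on_ray:
  fixes x u :: "'a::euclidean_space"
  assumes "norm (x + d *\<^sub>R u) \<le> r" "norm u = 1"
  shows "\<exists>t\<ge>d. norm (x + t *\<^sub>R u) = r"
proof -
  \<comment> \<open>Far enough along the ray to have left the open ball: the norm there is at least
    \<open>?m - norm x\<close>.\<close>
  let ?m = "max d (r + norm x)"
  have "r \<le> norm (x + ?m *\<^sub>R u)"
    using norm_triangle_ineq2[of "?m *\<^sub>R u" "- x"] assms(2) by (simp add: add.commute)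
  then show ?thesis
    using IVT'[of "\<lambda>t. norm (x + t *\<^sub>R u)" d r ?m] assms(1)
    by (force intro!: continuous_intros)
qed

text \<open>Going through either endpoint of the chord on which \<open>x\<close> and \<open>y\<close> lie, the two total
  lengths add up to twice the length of the chord.\<close>

lemma exists_sphere_point_dist_le:
  fixes x y :: "'a::euclidean_space"
  assumes x: "norm x \<le> r" and y: "norm y \<le> r"
  shows "\<exists>z. norm z = r \<and> dist x z + dist z y \<le> 2 * r"
proof -
  obtain u :: 'a and d where u: "norm u = 1" and d: "0 \<le> d" and yx: "y = x + d *\<^sub>R u"
  proof (cases "y = x")
    case True
    obtain u :: 'a where "norm u = 1" using vector_choose_size[of 1] by auto
    then show ?thesis using that[of u 0] True by simp
  next
    case False
    then show ?thesis using that[of "(y - x) /\<^sub>R norm (y - x)" "norm (y - x)"] by simp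
  qed
  obtain t where t: "d \<le> t" "norm (x + t *\<^sub>R u) = r"
    using exists_sphere_on_ray[of x d u r] y yx u by auto
  obtain t' where t': "0 \<le> t'" "norm (x + t' *\<^sub>R (- u)) = r"
    using exists_sphere_on_ray[of x 0 "- u" r] x u by auto
  define z z' where "z = x + t *\<^sub>R u" and "z' = x + t' *\<^sub>R (- u)"
  have dists: "dist x z = t" "dist z y = t - d" "dist x z' = t'" "dist z' y = t' + d"
  proof -
    have "z - y = (t - d) *\<^sub>R u" "y - z' = (t' + d) *\<^sub>R u"
      by (simp_all add: z_def z'_def yx algebra_simps)
    then show "dist z y = t - d" "dist z' y = t' + d"
      using t t' d u by (simp_all add: dist_norm norm_minus_commute[of z'])
    show "dist x z = t" "dist x z' = t'"
      using t t' d u by (simp_all add: dist_norm z_def z'_def)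
  qed
  have "z - z' = (t + t') *\<^sub>R u" by (simp add: z_def z'_def algebra_simps)
  then have "t + t' = norm (z - z')" using t t' d u by simp
  also have "\<dots> \<le> 2 * r" using norm_triangle_ineq4[of z z'] t t' by (simp add: z_def z'_def)
  finally have "dist x z + dist z y \<le> 2 * r \<or> dist x z' + dist z' y \<le> 2 * r"
    unfolding dists by linarith
  then show ?thesis using t t' unfolding z_def z'_def by blast
qed

lemma glued_dist_le:
  assumes "disc_chain r a b L"
  shows "glued_dist r a b \<le> L"
  unfolding glued_dist_def using assms
  by (intro cInf_lower bdd_belowI[of _ 0]) (auto dest: disc_chain_nonneg)

lemma glued_discs_diameter_eq:
  assumes "r \<ge> 0"
  shows "glued_discs_diameter r = 2 * r"
proof -
  have le: "glued_dist r a b \<le> 2 * r" if a: "a \<in> two_discs r" and b: "b \<in> two_discs r" for a b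
  proof -
    obtain s x s' y where ab: "a = (s, x)" "b = (s', y)" by fastforce
    then have x: "norm x \<le> r" and y: "norm y \<le> r" using a b by (auto simp: two_discs_def)
    obtain z where z: "norm z = r" "dist x z + dist z y \<le> 2 * r"
      using exists_sphere_point_dist_le[OF x y] by blast
    \<comment> \<open>\<open>switch\<close> may also keep the side, so one chain through the
      boundary point \<open>z\<close> serves for points on equal and on different sides.\<close>
    have "disc_chain r (s, x) (s', y) ((dist x z + 0) + dist z y)"
      using x y z by (intro disc_chain.concat[of r "(s, x)" "(s', z)"]
          disc_chain.concat[of r "(s, x)" "(s, z)"] disc_chain.jump disc_chain.switch) auto
    from glued_dist_le[OF this] z ab show ?thesis by simp
  qed
  \<comment> \<open>The two centres realise the diameter. This boundary point only shows that chains
    between them exist; the signed function takes the values \<open>-r\<close> and \<open>r\<close>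
    there, so no chain is shorter than \<open>2 * r\<close>.\<close>
  let ?z = "r *\<^sub>R axis 1 1 :: real^2"
  have "disc_chain r (False, 0) (False, ?z) (dist 0 ?z)"
    and "disc_chain r (False, ?z) (True, ?z) 0" and "disc_chain r (True, ?z) (True, 0) (dist ?z 0)"
    using assms by (intro disc_chain.jump disc_chain.switch; simp)+
  then have "disc_chain r (False, 0) (True, 0) (dist 0 ?z + 0 + dist ?z 0)"
    by (blast intro: disc_chain.concat)
  then have "2 * r \<le> glued_dist r (False, 0) (True, 0)"
    unfolding glued_dist_def using disc_chain_ge
    by (intro cInf_greatest) (fastforce)+
  moreover have "(False, 0) \<in> two_discs r" "(True, 0) \<in> two_discs r"
    using assms by (auto simp: two_discs_def)
  ultimately show ?thesis
    unfolding glued_discs_diameter_def using le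
    by (intro cSup_eq_maximum) (force intro: antisym)+
qed

theorem mainTheorem5:
  fixes g :: sphere_metric
  assumes "smooth_riemannian_metric g"
    and "S1_invariant g"
    and "area g = 4 * pi"
    and "corresponds_to_surface_of_revolution g"
  shows "riemannian_diameter g > 2 * sqrt 2 \<and>
    (\<forall>r. measure lebesgue (cball (0 :: real^2) r) = 2 * pi \<longrightarrow>
      glued_discs_diameter r = 2 * sqrt 2)"
proof
  obtain M F where "isometry_onto g M F" and "\<And>\<theta> x. x \<in> S2 \<Longrightarrow> F (rot \<theta> x) = rot \<theta> (F x)"
    using assms(4) unfolding corresponds_to_surface_of_revolution_def by blast
  then have "2 * sqrt 2 < integral {0..pi} (colat_speed g)"
    using assms(1-3) integral_colat_speed_gt by blast
  also have "\<dots> \<le> riemannian_diameter g"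
    using assms(1,2) by (rule riemannian_diameter_ge)
  finally show "riemannian_diameter g > 2 * sqrt 2" .
  show "\<forall>r. measure lebesgue (cball (0 :: real^2) r) = 2 * pi \<longrightarrow>
      glued_discs_diameter r = 2 * sqrt 2"
    unfolding measure_cball_real2_eq_iff by (simp add: glued_discs_diameter_eq)
qed

end
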